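(* Suppose that Assumptions A and B (stated in the context) hold. For each integer $b\ge2$ and each $\beta>0$ with $\beta<\beta_c:=2\pi^2/\log b$ there exist $\eta>0$ and $C>0$ such that for all $n\ge k\ge0$, $$0<\frac{a_k(q)}{a_k(0)}\le C e^{-\eta(k|q|+q^2)},\quad q\in\mathbb Z.$$ Moreover, each $v_k$ is a $C^\infty$ function with $$\sup_{z,z'\in\mathbb R}\bigl|v_{k+1}(z)-b\,v_k(z')\bigr|\le Ce^{-\eta k}$$ for all $n>k\ge0$, and $$\sup_{z\in\mathbb R}\max\bigl\{|v_k'(z)|,|v_k''(z)|\bigr\}\le Ce^{-\eta k}$$ for all $n\ge k\ge0$.
   Context: Let $b\ge2$ be an integer and $\beta>0$. Assumption A. $\{\mathfrak d_j\}_{j\ge0}$ is a positive sequence with $\sum_{j\ge0}\mathfrak d_j<\infty$ and, for each $n\ge1$, $\{\sigma_k^2\}_{k=0}^n$ is a strictly positive sequence (which may depend on $n$) with $|\sigma_k^2-1|\le\mathfrak d_{\min\{k,n-k\}}$ for $k=0,\dots,n$. Moreover $\inf_{n\ge k\ge0}\sigma_k^2>0$. Assumption B. $\nu$ is a $1$-periodic (positive) Radon measure on $\mathbb R$ whose Fourier coefficients $a(q):=\int_{[0,1)}e^{-2\pi iqz}\nu(dz)$, $q\in\mathbb Z$, are real-valued and strictly positive, with $a(-q)=a(q)$ for all $q$ and $\sup_{q\ge0}a(q+1)/a(q)<\infty$. Write $\mu_{s}$ for the normal law $\mathcal N(0,s)$. For each $n\ge1$ define functions $v_0,\dots,v_n\colon\mathbb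 R\to\mathbb R$ by $$e^{-v_0(z)}:=\int_{\mathbb R}e^{-\frac12\beta\sigma_0^{-2}(z-\zeta)^2}\nu(d\zeta),\qquad e^{-v_{k+1}(z)}:=\int_{\mathbb R}e^{-b\,v_k(z+\zeta)}\mu_{\sigma_{k+1}^2/\beta}(d\zeta),\quad k=0,\dots,n-1.$$ These are $1$-periodic. Set $a_k(q):=\int_0^1e^{-v_k(z)-2\pi iqz}\,dz$ for $q\in\mathbb Z$, $k=0,\dots,n$. The dependence of $\sigma_k^2,v_k,a_k$ on $n$ is suppressed; the constants $\eta,C$ do not depend on $n$ or $k$. *)

theory Defs
  imports "HOL-Probability.Probability"
begin

text \<open>
  Here s2 n k stands for the k-th variance (the squared sigma) in the sequence belonging to n.
  The infimum is taken in the reals; it is a genuine infimum because of the positivity clause.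
\<close>

definition assumption_A :: "(nat \<Rightarrow> real) \<Rightarrow> (nat \<Rightarrow> nat \<Rightarrow> real) \<Rightarrow> bool" where
  "assumption_A d s2 \<longleftrightarrow>
     (\<forall>j. 0 < d j) \<and> summable d \<and>
     (\<forall>n\<ge>1. \<forall>k\<le>n. 0 < s2 n k \<and> \<bar>s2 n k - 1\<bar> \<le> d (min k (n - k))) \<and>
     0 < (INF (n, k) \<in> {(n, k). 1 \<le> n \<and> k \<le> n}. s2 n k)"

text \<open>On the real line a Borel measure is Radon iff it is finite on compact sets.\<close>

definition radon_measure_on_line :: "real measure \<Rightarrow> bool" where
  "radon_measure_on_line M \<longleftrightarrow>
     sets M = sets borel \<and> (\<forall>K. compact K \<longrightarrow> emeasure M K < \<infinity>)"

definition fourier_coeff :: "real measure \<Rightarrow> int \<Rightarrow> complex" where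
  "fourier_coeff \<nu> q =
     (LINT z:{0..<1}|\<nu>. exp (- (2 * complex_of_real pi * \<i> * of_int q * complex_of_real z)))"

definition assumption_B :: "real measure \<Rightarrow> bool" where
  "assumption_B \<nu> \<longleftrightarrow>
     radon_measure_on_line \<nu> \<and>
     distr \<nu> borel (\<lambda>x. x + 1) = \<nu> \<and>
     (\<forall>q. fourier_coeff \<nu> q \<in> \<real> \<and> 0 < Re (fourier_coeff \<nu> q)) \<and>
     (\<forall>q. fourier_coeff \<nu> (- q) = fourier_coeff \<nu> q) \<and>
     bdd_above (range (\<lambda>q::nat. Re (fourier_coeff \<nu> (int q + 1)) / Re (fourier_coeff \<nu> (int q))))"

text \<open>The centred normal law of variance s; \<^const>\<open>normal_density\<close> takes the standard deviation.\<close>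

definition normal_law :: "real \<Rightarrow> real measure" where
  "normal_law s = density lborel (\<lambda>x. ennreal (normal_density 0 (sqrt s) x))"

text \<open>
  The functions are specified through their negative exponentials, so they are the negative
  logarithms of the integrals; s is the sequence of variances for the given n.
\<close>

primrec v :: "nat \<Rightarrow> real \<Rightarrow> real measure \<Rightarrow> (nat \<Rightarrow> real) \<Rightarrow> nat \<Rightarrow> real \<Rightarrow> real" where
  "v b \<beta> \<nu> s 0 =
     (\<lambda>z. - ln (LINT \<zeta>|\<nu>. exp (- (1/2) * \<beta> * inverse (s 0) * (z - \<zeta>)\<^sup>2)))"
| "v b \<beta> \<nu> s (Suc k) =
     (\<lambda>z. - ln (LINT \<zeta>|normal_law (s (Suc k) / \<beta>). exp (- real b * v b \<beta> \<nu> s k (z + \<zeta>))))"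

definition acoef :: "nat \<Rightarrow> real \<Rightarrow> real measure \<Rightarrow> (nat \<Rightarrow> real) \<Rightarrow> nat \<Rightarrow> int \<Rightarrow> complex" where
  "acoef b \<beta> \<nu> s k q =
     (LINT z:{0..1}|lborel. exp (- complex_of_real (v b \<beta> \<nu> s k z)
        - 2 * complex_of_real pi * \<i> * of_int q * complex_of_real z))"

definition smooth_real :: "(real \<Rightarrow> real) \<Rightarrow> bool" where
  "smooth_real f \<longleftrightarrow> (\<forall>m x. (deriv ^^ m) f differentiable (at x))"

end

theory Submission
  imports Defs "HOL-Complex_Analysis.Complex_Analysis"
begin

text \<open>
  Write f_k = e^{-v_k} and \<theta> = e^{-2\<pi>^2/\<beta>}. Raising a 1-periodic function to the
  power b convolves its Fourier coefficients b times, and averaging it against a centred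
  Gaussian of variance s multiplies the q-th coefficient by e^{-2\<pi>^2 q^2 s}. In Fourier
  space the recursion therefore reads a_{k+1}(q) = \<theta>^{\<sigma>_{k+1}^2 q^2} a_k^{*b}(q),
  and everything follows from controlling the quotients a_k(q+1)/a_k(q) for q \<ge> 0.

  The key observation (lemma ratio_bounded_convolution) is that these quotients are subadditive
  under convolution of positive sequences: in every term \<Prod>_i a(q_i) with
  q_1 + ... + q_b = q + 1 \<ge> 1 some q_i is at least 1 and may be lowered by one at the
  price of one factor c, and a given term of the sum for q is reached from at most b terms.
  Hence a bound c for a_k becomes bc for a_k^{*b}, and the Gaussian factor turns it into
  b \<theta>^{\<sigma>_{k+1}^2(2q+1)} c for a_{k+1}. Iterating, with summability of
  |\<sigma>_k^2 - 1|, the quotients are at most a constant times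
  (b\<theta>)^k \<theta>^{2 q \<sigma>_k^2}. The hypothesis \<beta> < \<beta>_c says exactly that
  b\<theta> < 1, and multiplying the quotients gives
  a_k(q)/a_k(0) \<le> C e^{-\<eta>(k|q| + q^2)}.

  The recursion starts from a Gaussian smoothing of the periodic measure. Its Fourier expansion
  comes from Poisson summation for the Gaussian, which is obtained from the uniqueness theorem for
  Fourier coefficients, itself a consequence of the Stone--Weierstrass theorem on the unit circle.

  For the regularity of v_k, the coefficient bound makes the Fourier series of f_k an entire
  function that differs from a_k(0) by at most a_k(0) times a constant multiple of
  e^{-\<eta> k} on the strip |Im w| \<le> 1; Cauchy's inequalities then bound the first two
  derivatives of f_k on the real line. To pass to the logarithm one needs f_k \<ge> m a_k(0)
  with m > 0 independent of k and n. For k \<ge> 1 this holds because the Gaussian density is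
  bounded below on [0,1] and the integral over a period of the function being averaged is exactly
  a_k(0); for k = 0 a periodized Gaussian plays the role of the density. Finally
  v_{k+1}(z) lies between b min v_k and b max v_k, as e^{-v_{k+1}} averages
  e^{-b v_k}, so the comparison of v_{k+1} with b v_k follows from the bound on v_k' and periodicity.
\<close>

section \<open>Sums indexed by the integers\<close>

text \<open>
  Enumerating the integers by the naturals reduces this to termwise integration of an ordinary
  series, that is, to dominated convergence.
\<close>

lemma integral_has_sum_int:
  fixes F :: "int \<Rightarrow> 'a \<Rightarrow> 'b::{banach, second_countable_topology}"
  assumes int: "\<And>q. integrable M (F q)"
    and summ: "(\<lambda>q. LINT x|M. norm (F q x)) summable_on UNIV"
    and G: "\<And>x. x \<in> space M \<Longrightarrow> ((\<lambda>q. F q x) has_sum G x) UNIV"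
    and abs: "\<And>x. x \<in> space M \<Longrightarrow> (\<lambda>q. norm (F q x)) summable_on UNIV"
  shows "integrable M G" and "((\<lambda>q. LINT x|M. F q x) has_sum (LINT x|M. G x)) UNIV"
proof -
  define f where "f n = F (int_decode n)" for n
  have s1: "summable (\<lambda>n. norm (f n x))" if "x \<in> space M" for x
    using abs[OF that] summable_on_reindex_bij_betw[OF bij_int_decode, of "\<lambda>q. norm (F q x)"]
    unfolding f_def by (intro summable_on_imp_summable) auto
  have s2: "summable (\<lambda>n. LINT x|M. norm (f n x))"
    using summ summable_on_reindex_bij_betw[OF bij_int_decode, of "\<lambda>q. LINT x|M. norm (F q x)"]
    unfolding f_def by (intro summable_on_imp_summable) auto
  have i: "integrable M (f n)" for n unfolding f_def by (rule int)
  have eq: "(\<Sum>n. f n x) = G x" if "x \<in> space M" for x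
  proof -
    have "((\<lambda>n. f n x) has_sum G x) UNIV"
      using G[OF that] has_sum_reindex_bij_betw[OF bij_int_decode, of "\<lambda>q. F q x"]
      unfolding f_def by simp
    then show ?thesis using has_sum_imp_sums sums_unique by metis
  qed
  have "integrable M (\<lambda>x. \<Sum>n. f n x)"
    by (rule integrable_suminf[OF i AE_I2[OF s1] s2])
  then show "integrable M G"
    using Bochner_Integration.integrable_cong[of M M "\<lambda>x. \<Sum>n. f n x" G] eq by simp
  have su: "(\<lambda>n. LINT x|M. f n x) sums (LINT x|M. (\<Sum>n. f n x))"
    by (rule sums_integral[OF i AE_I2[OF s1] s2])
  also have "(LINT x|M. (\<Sum>n. f n x)) = (LINT x|M. G x)"
    using eq by (intro Bochner_Integration.integral_cong) auto
  finally have su: "(\<lambda>n. LINT x|M. f n x) sums (LINT x|M. G x)" .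
  have "summable (\<lambda>n. norm (LINT x|M. f n x))"
    by (rule summable_comparison_test'[OF s2, of 0]) simp
  then have "((\<lambda>n. LINT x|M. f n x) has_sum (LINT x|M. G x)) UNIV"
    using su by (rule norm_summable_imp_has_sum)
  then show "((\<lambda>q. LINT x|M. F q x) has_sum (LINT x|M. G x)) UNIV"
    using has_sum_reindex_bij_betw[OF bij_int_decode, of "\<lambda>q. LINT x|M. F q x"]
    unfolding f_def by simp
qed

lemma continuous_on_has_sum:
  fixes F :: "int \<Rightarrow> real \<Rightarrow> 'b::banach"
  assumes "\<And>q. continuous_on S (F q)" and bd: "\<And>q x. x \<in> S \<Longrightarrow> norm (F q x) \<le> B q"
    and B: "B summable_on UNIV" and hs: "\<And>x. x \<in> S \<Longrightarrow> ((\<lambda>q. F q x) has_sum G x) UNIV"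
  shows "continuous_on S G"
proof -
  have s: "summable (\<lambda>n. B (int_decode n))"
    using B summable_on_reindex_bij_betw[OF bij_int_decode, of B]
    by (intro summable_on_imp_summable) auto
  have "uniform_limit S (\<lambda>n x. \<Sum>i<n. F (int_decode i) x) (\<lambda>x. suminf (\<lambda>i. F (int_decode i) x)) sequentially"
    by (rule Weierstrass_m_test[OF _ s]) (use bd in auto)
  then have c: "continuous_on S (\<lambda>x. suminf (\<lambda>i. F (int_decode i) x))"
    by (rule uniform_limit_theorem[rotated])
       (auto intro!: always_eventually continuous_intros assms(1))
  have "suminf (\<lambda>i. F (int_decode i) x) = G x" if "x \<in> S" for x
  proof -
    have "((\<lambda>n. F (int_decode n) x) has_sum G x) UNIV"
      using hs[OF that] has_sum_reindex_bij_betw[OF bij_int_decode, of "\<lambda>q. F q x"] by simp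
    then show ?thesis using has_sum_imp_sums sums_unique by metis
  qed
  with c show ?thesis by (simp cong: continuous_on_cong_simp)
qed

lemma summable_on_int_from_halves:
  fixes f :: "int \<Rightarrow> real"
  assumes "\<And>q. 0 \<le> f q" and "summable (\<lambda>n. f (int n))" and "summable (\<lambda>n. f (- int n))"
  shows "f summable_on UNIV"
proof -
  have 1: "f summable_on range int"
    by (subst summable_on_reindex) (use assms in \<open>auto simp: summable_on_UNIV_nonneg_real_iff o_def\<close>)
  have 2: "f summable_on range (\<lambda>n. - int n)"
    by (subst summable_on_reindex) (use assms in \<open>auto simp: summable_on_UNIV_nonneg_real_iff o_def inj_on_def\<close>)
  have "range int \<union> range (\<lambda>n. - int n) = UNIV"
  proof (intro equalityI subsetI UNIV_I)
    fix q :: int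
    show "q \<in> range int \<union> range (\<lambda>n. - int n)"
      by (cases q rule: int_cases2) auto
  qed
  then show ?thesis using summable_on_union[OF 1 2] by simp
qed

text \<open>
  The maximum of the parabola, found by completing the square. It is used whenever a linear
  exponent has to be absorbed by part of a Gaussian one.
\<close>

lemma quadratic_upper_bound:
  fixes e L x :: real
  assumes "e > 0"
  shows "- e * x\<^sup>2 + L * x \<le> L\<^sup>2 / (4 * e)"
proof -
  have "L\<^sup>2 / (4 * e) - (- e * x\<^sup>2 + L * x) = e * (x - L / (2 * e))\<^sup>2"
    using assms by (simp add: field_simps power2_eq_square)
  also have "\<dots> \<ge> 0" using assms by simp
  finally show ?thesis by simp
qed

lemma summable_on_exp_quadratic:
  fixes e L :: real
  assumes "e > 0"
  shows "(\<lambda>q::int. exp (- e * (of_int q)\<^sup>2 + L * \<bar>of_int q\<bar>)) summable_on UNIV"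
proof -
  define K where "K = exp ((L + 1)\<^sup>2 / (4 * e))"
  have s: "summable (\<lambda>n. K * exp (- 1) ^ n)"
    by (intro summable_mult summable_geometric) simp
  have b: "exp (- e * (real n)\<^sup>2 + L * real n) \<le> K * exp (- 1) ^ n" for n
  proof -
    have "- e * (real n)\<^sup>2 + L * real n \<le> (L + 1)\<^sup>2 / (4 * e) + real n * (- 1)"
      using quadratic_upper_bound[OF assms, of "real n" "L + 1"] by (simp add: algebra_simps)
    then have "exp (- e * (real n)\<^sup>2 + L * real n) \<le> exp ((L + 1)\<^sup>2 / (4 * e) + real n * (- 1))"
      by (simp only: exp_le_cancel_iff)
    also have "\<dots> = K * exp (- 1) ^ n"
      by (simp only: K_def exp_add exp_of_nat_mult)
    finally show ?thesis .
  qed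
  have "summable (\<lambda>n. exp (- e * (real n)\<^sup>2 + L * real n))"
    by (rule summable_comparison_test'[OF s, of 0]) (use b in auto)
  then show ?thesis by (intro summable_on_int_from_halves) auto
qed

section \<open>Trigonometric series with positive coefficients\<close>

definition trig :: "int \<Rightarrow> real \<Rightarrow> complex" where
  "trig q x = cis (2 * pi * of_int q * x)"

lemma norm_trig [simp]: "norm (trig q x) = 1"
  by (simp add: trig_def)

lemma trig_0 [simp]: "trig 0 x = 1" "trig q 0 = 1"
  by (simp_all add: trig_def)

lemma trig_add: "trig (p + q) x = trig p x * trig q x" "trig q (x + y) = trig q x * trig q y"
  by (simp_all add: trig_def cis_mult algebra_simps)

lemma trig_of_int [simp]: "trig q (of_int m) = 1"
proof -
  have "trig q (of_int m) = cis (2 * pi * of_int (q * m))"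
    by (simp add: trig_def mult_ac)
  also have "\<dots> = 1" by (intro cis_multiple_2pi) auto
  finally show ?thesis .
qed

lemma continuous_on_trig [continuous_intros]:
  "continuous_on A f \<Longrightarrow> continuous_on A (\<lambda>x. trig q (f x))"
  unfolding trig_def by (intro continuous_intros)

lemma measurable_trig [measurable]: "trig q \<in> borel_measurable borel"
  by (intro borel_measurable_continuous_onI continuous_intros)

lemma integral_trig: "(LINT x:{0..1}|lborel. trig q x) = (if q = 0 then 1 else 0)"
proof (cases "q = 0")
  case True
  then show ?thesis by (simp add: set_lebesgue_integral_def)
next
  case False
  define c where "c = 2 * complex_of_real pi * \<i> * of_int q"
  have c: "c \<noteq> 0" using False by (simp add: c_def)
  have e: "trig q x = exp (c * of_real x)" for x
    by (simp add: trig_def cis_conv_exp c_def mult_ac)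
  have D: "((\<lambda>x. trig q x / c) has_vector_derivative trig q x) (at x within A)" for x A
    unfolding e
    by (rule has_vector_derivative_real_field)
       (auto intro!: derivative_eq_intros simp: c)
  have "(LBINT x. indicator {0..1} x *\<^sub>R trig q x) = trig q 1 / c - trig q 0 / c"
    by (rule integral_FTC_Icc) (auto intro!: D continuous_intros)
  also have "\<dots> = 0" using trig_of_int[of q 1] by simp
  finally show ?thesis using False by (simp add: set_lebesgue_integral_def)
qed

lemma set_integrable_trig: "set_integrable lborel {0..1} (trig q)"
  by (intro borel_integrable_atLeastAtMost' continuous_intros)

text \<open>
  Termwise integration, justified by absolute summability, and orthogonality of the characters.
\<close>

lemma fourier_coefficient_of_series:
  fixes c :: "int \<Rightarrow> complex"
  assumes c: "(\<lambda>q. norm (c q)) summable_on UNIV"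
    and h: "\<And>x. ((\<lambda>q. c q * trig q x) has_sum h x) UNIV"
  shows "(LINT x:{0..1}|lborel. h x * trig (- p) x) = c p"
proof -
  let ?F = "\<lambda>q x. indicat_real {0..1} x *\<^sub>R (c q * trig (q - p) x)"
  have int: "integrable lborel (?F q)" for q
    using integrable_mult_right[OF set_integrable_trig[of "q - p", unfolded set_integrable_def], of "c q"]
    by simp
  have norm: "(LINT x|lborel. norm (?F q x)) = norm (c q)" for q
    by (simp add: norm_mult)
  have hs: "((\<lambda>q. ?F q x) has_sum indicat_real {0..1} x *\<^sub>R (h x * trig (- p) x)) UNIV" for x
  proof -
    have "((\<lambda>q. indicat_real {0..1} x *\<^sub>R (c q * trig q x * trig (- p) x))
       has_sum indicat_real {0..1} x *\<^sub>R (h x * trig (- p) x)) UNIV"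
      by (intro has_sum_scaleR has_sum_cmult_left h)
    then show ?thesis by (simp add: mult.assoc flip: trig_add(1))
  qed
  have ab: "(\<lambda>q. norm (?F q x)) summable_on UNIV" for x
    by (simp add: norm_mult) (intro summable_on_cmult_right c)
  have *: "((\<lambda>q. LINT x|lborel. ?F q x) has_sum (LINT x:{0..1}|lborel. h x * trig (- p) x)) UNIV"
    unfolding set_lebesgue_integral_def
    by (rule integral_has_sum_int(2)[OF int _ hs ab]) (use norm c in simp_all)
  have "(LINT x|lborel. ?F q x) = (if q = p then c p else 0)" for q
  proof -
    have "(LINT x|lborel. ?F q x) = c q * (LINT x:{0..1}|lborel. trig (q - p) x)"
      unfolding set_lebesgue_integral_def
      by (subst integral_mult_right_zero [symmetric]) (simp add: mult_ac)
    then show ?thesis by (simp add: integral_trig)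
  qed
  with * have "((\<lambda>q. if q = p then c p else 0) has_sum (LINT x:{0..1}|lborel. h x * trig (- p) x)) UNIV"
    by simp
  moreover have "((\<lambda>q. if q = p then c p else 0) has_sum c p) UNIV"
    by (rule has_sum_finite_neutralI[of "{p}"]) auto
  ultimately show ?thesis by (rule has_sum_unique)
qed

text \<open>
  The Cauchy product: the double family (j, l) \<mapsto> c_j d_l is absolutely summable, and
  summing it along the lines j + l = q gives the same total.
\<close>

lemma has_sum_convolution:
  fixes c d :: "int \<Rightarrow> complex"
  assumes c: "(\<lambda>q. norm (c q)) summable_on UNIV" and d: "(\<lambda>q. norm (d q)) summable_on UNIV"
    and C: "(c has_sum C) UNIV" and D: "(d has_sum D) UNIV"
  shows "((\<lambda>q. \<Sum>\<^sub>\<infinity>j. c j * d (q - j)) has_sum C * D) UNIV"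
    and "(\<lambda>q. norm (\<Sum>\<^sub>\<infinity>j. c j * d (q - j))) summable_on UNIV"
    and "\<And>q. (\<lambda>j. c j * d (q - j)) summable_on UNIV"
proof -
  have ab: "(\<lambda>z. norm (case z of (x, y) \<Rightarrow> c x * d y)) summable_on (UNIV \<times> UNIV)"
    by (subst Infinite_Sum.abs_summable_on_Sigma_iff)
       (auto simp: norm_mult infsum_cmult_right' infsum_nonneg
         intro!: summable_on_cmult_right summable_on_cmult_left c d)
  have hs: "((\<lambda>(x, y). c x * d y) has_sum C * D) (UNIV \<times> UNIV)"
  proof (rule has_sum_SigmaI)
    show "((\<lambda>y. (\<lambda>(x, y). c x * d y) (x, y)) has_sum c x * D) UNIV" for x
      using has_sum_cmult_right[OF D] by simp
    show "((\<lambda>x. c x * D) has_sum C * D) UNIV"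
      by (rule has_sum_cmult_left[OF C])
    show "(\<lambda>(x, y). c x * d y) summable_on UNIV \<times> UNIV"
      by (rule abs_summable_summable[OF ab])
  qed
  have bij: "bij_betw (\<lambda>(q, j). (j, q - j)) (UNIV \<times> UNIV) (UNIV \<times> (UNIV :: int set))"
    by (rule bij_betwI[where g = "\<lambda>(j, l). (j + l, j)"]) auto
  have hs': "((\<lambda>(q, j). c j * d (q - j)) has_sum C * D) (UNIV \<times> UNIV)"
    using has_sum_reindex_bij_betw[OF bij, of "\<lambda>(x, y). c x * d y"] hs
    by (simp add: case_prod_unfold)
  have ab': "(\<lambda>z. norm (case z of (q, j) \<Rightarrow> c j * d (q - j))) summable_on (UNIV \<times> UNIV)"
    using summable_on_reindex_bij_betw[OF bij, of "\<lambda>x. norm ((\<lambda>(x, y). c x * d y) x)"] ab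
    by (simp add: case_prod_unfold)
  have ab2: "(\<lambda>j. norm (c j * d (q - j))) summable_on UNIV"
       "(\<lambda>q. norm (\<Sum>\<^sub>\<infinity>j. norm (c j * d (q - j)))) summable_on UNIV" for q
    using ab'[unfolded Infinite_Sum.abs_summable_on_Sigma_iff] by simp_all
  show s: "(\<lambda>j. c j * d (q - j)) summable_on UNIV" for q
    by (rule abs_summable_summable[OF ab2(1)])
  show "((\<lambda>q. \<Sum>\<^sub>\<infinity>j. c j * d (q - j)) has_sum C * D) UNIV"
    by (rule has_sum_SigmaD[OF hs']) (simp add: s)
  show "(\<lambda>q. norm (\<Sum>\<^sub>\<infinity>j. c j * d (q - j))) summable_on UNIV"
  proof (rule summable_on_comparison_test)
    show "(\<lambda>q. \<Sum>\<^sub>\<infinity>j. norm (c j * d (q - j))) summable_on UNIV"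
      using ab2(2) by (simp add: infsum_nonneg)
    show "norm (\<Sum>\<^sub>\<infinity>j. c j * d (q - j)) \<le> (\<Sum>\<^sub>\<infinity>j. norm (c j * d (q - j)))" for q
      by (rule norm_infsum_bound[OF ab2(1)])
  qed simp
qed

text \<open>
  Positivity and evenness of the coefficients are part of the predicate because both are preserved by
  products and by Gaussian averages; positivity makes absolute convergence the same as
  summability of the coefficients, and evenness makes the sum real.
\<close>

definition fourier_series :: "(int \<Rightarrow> real) \<Rightarrow> (real \<Rightarrow> real) \<Rightarrow> bool" where
  "fourier_series A f \<longleftrightarrow>
     (\<forall>q. 0 < A q) \<and> (\<forall>q. A (- q) = A q) \<and> A summable_on UNIV \<and>
     (\<forall>x. ((\<lambda>q. of_real (A q) * trig q x) has_sum of_real (f x)) UNIV)"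

lemma fourier_seriesD:
  assumes "fourier_series A f"
  shows "0 < A q" "A (- q) = A q" "A summable_on UNIV"
    "((\<lambda>q. of_real (A q) * trig q x) has_sum of_real (f x)) UNIV"
    "(\<lambda>q. norm (complex_of_real (A q) * trig q x)) summable_on UNIV"
    "(\<lambda>q. norm (complex_of_real (A q))) summable_on UNIV"
proof -
  show "0 < A q" "A (- q) = A q" "A summable_on UNIV"
    "((\<lambda>q. of_real (A q) * trig q x) has_sum of_real (f x)) UNIV"
    using assms by (auto simp: fourier_series_def)
  have "\<bar>A q\<bar> = A q" for q
    using assms by (simp add: fourier_series_def less_imp_le)
  then show "(\<lambda>q. norm (complex_of_real (A q) * trig q x)) summable_on UNIV"
    "(\<lambda>q. norm (complex_of_real (A q))) summable_on UNIV"
    using assms by (simp_all add: norm_mult fourier_series_def)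
qed

lemma fourier_series_exists:
  assumes pos: "\<And>q. 0 < A q" and even: "\<And>q. A (- q) = A q" and s: "A summable_on UNIV"
  shows "\<exists>f. fourier_series A f"
proof -
  define F where "F x = (\<Sum>\<^sub>\<infinity>q. of_real (A q) * trig q x)" for x
  have "\<bar>A q\<bar> = A q" for q using pos[of q] by simp
  then have "(\<lambda>q. norm (complex_of_real (A q) * trig q x)) summable_on UNIV" for x
    using s by (simp add: norm_mult)
  then have "(\<lambda>q. complex_of_real (A q) * trig q x) summable_on UNIV" for x
    by (rule abs_summable_summable)
  then have hs: "((\<lambda>q. complex_of_real (A q) * trig q x) has_sum F x) UNIV" for x
    unfolding F_def by (rule has_sum_infsum)
  have "cnj (F x) = F x" for x
  proof -
    have "((\<lambda>q. cnj (complex_of_real (A q) * trig q x)) has_sum cnj (F x)) UNIV"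
      using hs[of x] by (simp only: has_sum_cnj_iff)
    moreover have "cnj (complex_of_real (A q) * trig q x) = complex_of_real (A (- q)) * trig (- q) x" for q
      by (simp add: even trig_def cis_cnj)
    ultimately have "((\<lambda>q. complex_of_real (A (- q)) * trig (- q) x) has_sum cnj (F x)) UNIV"
      by simp
    then have "((\<lambda>q. complex_of_real (A q) * trig q x) has_sum cnj (F x)) UNIV"
      using has_sum_reindex_bij_betw[OF bij_uminus, of "\<lambda>q. complex_of_real (A q) * trig q x"] by simp
    then show ?thesis using hs has_sum_unique by blast
  qed
  then have "of_real (Re (F x)) = F x" for x
    by (metis complex_cnj_cancel_iff Reals_cnj_iff of_real_Re)
  then have "fourier_series A (\<lambda>x. Re (F x))"
    unfolding fourier_series_def using pos even s hs by auto
  then show ?thesis by blast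
qed

lemma fourier_series_periodic:
  assumes "fourier_series A f"
  shows "f (x + of_int m) = f x"
proof -
  have "((\<lambda>q. of_real (A q) * trig q x) has_sum of_real (f (x + of_int m))) UNIV"
    using fourier_seriesD(4)[OF assms, of "x + of_int m"] by (simp add: trig_add)
  then have "complex_of_real (f (x + of_int m)) = of_real (f x)"
    using fourier_seriesD(4)[OF assms, of x] by (rule has_sum_unique)
  then show ?thesis by simp
qed

lemma fourier_series_even:
  assumes "fourier_series A f"
  shows "f (- x) = f x"
proof -
  have "((\<lambda>q. of_real (A (- q)) * trig (- q) (- x)) has_sum of_real (f (- x))) UNIV"
    using fourier_seriesD(4)[OF assms, of "- x"]
      has_sum_reindex_bij_betw[OF bij_uminus, of "\<lambda>q. of_real (A q) * trig q (- x)"] by simp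
  then have "((\<lambda>q. of_real (A q) * trig q x) has_sum of_real (f (- x))) UNIV"
    by (simp add: fourier_seriesD(2)[OF assms] trig_def)
  then have "complex_of_real (f (- x)) = of_real (f x)"
    using fourier_seriesD(4)[OF assms, of x] by (rule has_sum_unique)
  then show ?thesis by simp
qed

lemma fourier_series_bound:
  assumes "fourier_series A f"
  shows "\<bar>f x\<bar> \<le> infsum A UNIV"
proof -
  have "\<bar>A q\<bar> = A q" for q
    using assms by (simp add: fourier_series_def less_imp_le)
  then have *: "norm (complex_of_real (A q) * trig q x) = A q" for q
    by (simp add: norm_mult)
  have "norm (complex_of_real (f x)) \<le> infsum (\<lambda>q. norm (complex_of_real (A q) * trig q x)) UNIV"
    using norm_infsum_bound[OF fourier_seriesD(5)[OF assms], of x]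
      infsumI[OF fourier_seriesD(4)[OF assms], of x] by simp
  then show ?thesis by (simp add: *)
qed

lemma fourier_series_continuous:
  assumes "fourier_series A f"
  shows "continuous_on UNIV f"
proof -
  have A: "\<bar>A q\<bar> = A q" for q
    using assms by (simp add: fourier_series_def less_imp_le)
  have "continuous_on UNIV (\<lambda>x. complex_of_real (f x))"
    by (rule continuous_on_has_sum[OF _ _ fourier_seriesD(3)[OF assms] fourier_seriesD(4)[OF assms]])
       (auto simp: norm_mult A intro!: continuous_intros)
  then have "continuous_on UNIV (\<lambda>x. Re (complex_of_real (f x)))"
    by (rule continuous_on_Re)
  then show ?thesis by simp
qed

lemma fourier_series_coefficient:
  assumes "fourier_series A f"
  shows "(LINT x:{0..1}|lborel. of_real (f x) * trig (- q) x) = complex_of_real (A q)"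
  by (rule fourier_coefficient_of_series[OF fourier_seriesD(6,4)[OF assms]])

text \<open>
  Shifting the argument only multiplies the q-th coefficient by a phase, which is trivial for
  q = 0.
\<close>

lemma fourier_series_mean:
  assumes "fourier_series A f"
  shows "(LINT x:{0..1}|lborel. f (z + x)) = A 0"
proof -
  have h: "((\<lambda>q. (of_real (A q) * trig q z) * trig q x) has_sum of_real (f (z + x))) UNIV" for x
    using fourier_seriesD(4)[OF assms, of "z + x"] by (simp add: trig_add mult.assoc)
  have "(LINT x:{0..1}|lborel. complex_of_real (f (z + x))) = of_real (A 0)"
    using fourier_coefficient_of_series[OF fourier_seriesD(5)[OF assms] h, of 0] by simp
  moreover have "(LINT x:{0..1}|lborel. complex_of_real (f (z + x)))
      = of_real (LINT x:{0..1}|lborel. f (z + x))"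
    by (rule set_integral_complex_of_real)
  ultimately show ?thesis by (metis of_real_eq_iff)
qed

section \<open>Growth quotients under convolution\<close>

text \<open>
  For an even sequence the quotients at negative indices are the reciprocals of these, so only
  q \<ge> 0 carries a constraint.
\<close>

definition ratio_bounded :: "(int \<Rightarrow> real) \<Rightarrow> real \<Rightarrow> bool" where
  "ratio_bounded A c \<longleftrightarrow> (\<forall>q\<ge>0. A (q + 1) \<le> c * A q)"

lemma summable_on_shift:
  fixes f :: "int \<Rightarrow> 'a::{comm_monoid_add,topological_space}"
  shows "(\<lambda>j. f (j + a)) summable_on UNIV \<longleftrightarrow> f summable_on UNIV"
  by (rule summable_on_reindex_bij_betw) (rule bij_betwI[where g = "\<lambda>j. j - a"], auto)

lemma infsum_shift:
  fixes f :: "int \<Rightarrow> 'a::{comm_monoid_add,t2_space}"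
  shows "(\<Sum>\<^sub>\<infinity>j. f (j + a)) = infsum f UNIV"
  by (rule infsum_reindex_bij_betw) (rule bij_betwI[where g = "\<lambda>j. j - a"], auto)

text \<open>
  Split the sum for q + 1 into the terms with j \<ge> 1 and those with j \<le> 0. In the former
  the index of A can be lowered from j to j - 1; in the latter q + 1 - j \<ge> 1, so the
  index of B can be lowered instead. Both halves are then dominated by the convolution at q.
\<close>

lemma ratio_bounded_convolution:
  fixes A B :: "int \<Rightarrow> real"
  assumes A: "\<And>q. 0 \<le> A q" "ratio_bounded A c" and B: "\<And>q. 0 \<le> B q" "ratio_bounded B d"
    and c: "0 \<le> c" and d: "0 \<le> d"
    and s: "\<And>q. (\<lambda>j. A j * B (q - j)) summable_on UNIV"
  shows "ratio_bounded (\<lambda>q. \<Sum>\<^sub>\<infinity>j. A j * B (q - j)) (c + d)"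
  unfolding ratio_bounded_def
proof (intro allI impI)
  fix q :: int
  assume q: "0 \<le> q"
  have s1: "(\<lambda>j. A (j - 1) * B (q + 1 - j)) summable_on UNIV"
    using summable_on_shift[of "\<lambda>j. A j * B (q - j)" "- 1"] s[of q] by (simp add: algebra_simps)
  have e1: "(\<Sum>\<^sub>\<infinity>j. A (j - 1) * B (q + 1 - j)) = (\<Sum>\<^sub>\<infinity>j. A j * B (q - j))"
    using infsum_shift[of "\<lambda>j. A j * B (q - j)" "- 1"] by (simp add: algebra_simps)
  \<comment> \<open>Both terms on the right are nonnegative, so one of them suffices in each case.\<close>
  have le: "A j * B (q + 1 - j) \<le> c * (A (j - 1) * B (q + 1 - j)) + d * (A j * B (q - j))" for j
  proof (cases "j \<ge> 1")
    case True
    then have "A j \<le> c * A (j - 1)"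
      using A(2) unfolding ratio_bounded_def by (metis diff_add_cancel diff_ge_0_iff_ge)
    then have "A j * B (q + 1 - j) \<le> c * (A (j - 1) * B (q + 1 - j))"
      using mult_right_mono[OF _ B(1)] by (metis mult.assoc)
    moreover have "0 \<le> d * (A j * B (q - j))" using A B d by simp
    ultimately show ?thesis by linarith
  next
    case False
    then have "0 \<le> q - j" using q by simp
    then have "B (q - j + 1) \<le> d * B (q - j)"
      using B(2) unfolding ratio_bounded_def by blast
    then have "A j * B (q + 1 - j) \<le> A j * (d * B (q - j))"
      by (intro mult_left_mono A) (simp add: algebra_simps)
    moreover have "0 \<le> c * (A (j - 1) * B (q + 1 - j))" using A B c by simp
    ultimately show ?thesis by (simp add: algebra_simps)
  qed
  have "(\<Sum>\<^sub>\<infinity>j. A j * B (q + 1 - j)) \<le> (\<Sum>\<^sub>\<infinity>j. c * (A (j - 1) * B (q + 1 - j)) + d * (A j * B (q - j)))"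
    by (intro infsum_mono s summable_on_add summable_on_cmult_right s1 le)
  also have "\<dots> = (\<Sum>\<^sub>\<infinity>j. c * (A (j - 1) * B (q + 1 - j))) + (\<Sum>\<^sub>\<infinity>j. d * (A j * B (q - j)))"
    by (intro infsum_add summable_on_cmult_right s s1)
  also have "\<dots> = (c + d) * (\<Sum>\<^sub>\<infinity>j. A j * B (q - j))"
    by (simp only: infsum_cmult_right' e1 distrib_right)
  finally show "(\<Sum>\<^sub>\<infinity>j. A j * B (q + 1 - j)) \<le> (c + d) * (\<Sum>\<^sub>\<infinity>j. A j * B (q - j))" .
qed

lemma fourier_series_mult:
  assumes A: "fourier_series A f" and B: "fourier_series B g"
  shows "fourier_series (\<lambda>q. \<Sum>\<^sub>\<infinity>j. A j * B (q - j)) (\<lambda>x. f x * g x)"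
    and "(\<lambda>j. A j * B (q - j)) summable_on UNIV"
proof -
  note cv = has_sum_convolution[OF fourier_seriesD(5)[OF A] fourier_seriesD(5)[OF B]
      fourier_seriesD(4)[OF A] fourier_seriesD(4)[OF B]]
  have "(\<lambda>j. complex_of_real (A j * B (q - j))) summable_on UNIV" for q
    using cv(3)[of 0 q 0] by simp
  from summable_on_Re[OF this]
  show s: "(\<lambda>j. A j * B (q - j)) summable_on UNIV" for q
    by simp
  have eq: "(\<Sum>\<^sub>\<infinity>j. of_real (A j) * trig j x * (of_real (B (q - j)) * trig (q - j) x))
      = complex_of_real (\<Sum>\<^sub>\<infinity>j. A j * B (q - j)) * trig q x" for q x
  proof -
    have "of_real (A j) * trig j x * (of_real (B (q - j)) * trig (q - j) x)
        = complex_of_real (A j * B (q - j)) * trig q x" for j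
    proof -
      have "trig q x = trig j x * trig (q - j) x"
        using trig_add(1)[of j "q - j" x] by simp
      then show ?thesis by (simp only: of_real_mult mult_ac)
    qed
    moreover have "((\<lambda>j. complex_of_real (A j * B (q - j)) * trig q x) has_sum
        complex_of_real (\<Sum>\<^sub>\<infinity>j. A j * B (q - j)) * trig q x) UNIV"
      by (intro has_sum_cmult_left has_sum_of_real has_sum_infsum s)
    ultimately show ?thesis by (simp only: infsumI)
  qed
  show "fourier_series (\<lambda>q. \<Sum>\<^sub>\<infinity>j. A j * B (q - j)) (\<lambda>x. f x * g x)"
    unfolding fourier_series_def
  proof (intro conjI allI)
    show "0 < (\<Sum>\<^sub>\<infinity>j. A j * B (q - j))" for q
    proof -
      have "0 < A 0 * B (q - 0)" by (simp add: fourier_seriesD(1)[OF A] fourier_seriesD(1)[OF B])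
      also have "\<dots> = (\<Sum>j\<in>{0}. A j * B (q - j))" by simp
      also have "\<dots> \<le> (\<Sum>\<^sub>\<infinity>j. A j * B (q - j))"
        by (rule finite_sum_le_infsum[OF s])
           (simp_all add: fourier_seriesD(1)[OF A] fourier_seriesD(1)[OF B] less_imp_le)
      finally show ?thesis .
    qed
    show "(\<Sum>\<^sub>\<infinity>j. A j * B (- q - j)) = (\<Sum>\<^sub>\<infinity>j. A j * B (q - j))" for q
    proof -
      have e: "A (- j) * B (q - - j) = A j * B (- q - j)" for j
        using fourier_seriesD(2)[OF A, of j] fourier_seriesD(2)[OF B, of "q + j"] by simp
      have "(\<Sum>\<^sub>\<infinity>j. A (- j) * B (q - - j)) = (\<Sum>\<^sub>\<infinity>j. A j * B (q - j))"
        using infsum_reindex_bij_betw[OF bij_uminus, of "\<lambda>j. A j * B (q - j)"] by simp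
      then show ?thesis unfolding e .
    qed
    show "(\<lambda>q. \<Sum>\<^sub>\<infinity>j. A j * B (q - j)) summable_on UNIV"
    proof -
      have "(\<lambda>q. norm (\<Sum>\<^sub>\<infinity>j. A j * B (q - j))) summable_on UNIV"
        using cv(2)[of 0 0] unfolding eq by simp
      then show ?thesis by (subst summable_on_iff_abs_summable_on_real)
    qed
    show "((\<lambda>q. complex_of_real (\<Sum>\<^sub>\<infinity>j. A j * B (q - j)) * trig q x) has_sum of_real (f x * g x)) UNIV" for x
      using cv(1)[of x x] unfolding eq by simp
  qed
qed

text \<open>
  The convolution bound adds the constants, hence the factor n.
\<close>

lemma fourier_series_power:
  assumes A: "fourier_series A f" "ratio_bounded A c" "0 \<le> c" and n: "n \<ge> 1"
  shows "\<exists>P. fourier_series P (\<lambda>x. f x ^ n) \<and> ratio_bounded P (real n * c)"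
  using n
proof (induction n rule: dec_induct)
  case base
  then show ?case using A by auto
next
  case (step n)
  then obtain P where P: "fourier_series P (\<lambda>x. f x ^ n)" "ratio_bounded P (real n * c)"
    by auto
  have "ratio_bounded (\<lambda>q. \<Sum>\<^sub>\<infinity>j. A j * P (q - j)) (c + real n * c)"
    by (rule ratio_bounded_convolution)
       (simp_all add: A P fourier_seriesD(1)[OF A(1)] fourier_seriesD(1)[OF P(1)] less_imp_le
         fourier_series_mult(2)[OF A(1) P(1)])
  moreover have "fourier_series (\<lambda>q. \<Sum>\<^sub>\<infinity>j. A j * P (q - j)) (\<lambda>x. f x ^ Suc n)"
    using fourier_series_mult(1)[OF A(1) P(1)] by simp
  moreover have "c + real n * c = real (Suc n) * c" by (simp add: algebra_simps)
  ultimately show ?case by metis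
qed

section \<open>Uniqueness of Fourier coefficients\<close>

definition orthogonal_to_trig :: "(real \<Rightarrow> complex) \<Rightarrow> bool" where
  "orthogonal_to_trig u \<longleftrightarrow>
     continuous_on UNIV u \<and> (\<forall>q. (LINT x:{0..1}|lborel. u x * trig q x) = 0)"

lemma set_integrable_continuous_01:
  fixes u :: "real \<Rightarrow> 'a::{banach, second_countable_topology}"
  assumes "continuous_on UNIV u"
  shows "set_integrable lborel {0..1} u"
  by (intro borel_integrable_atLeastAtMost' continuous_on_subset[OF assms]) auto

lemma orthogonal_to_trig_add:
  assumes "orthogonal_to_trig u" "orthogonal_to_trig w"
  shows "orthogonal_to_trig (\<lambda>x. u x + w x)"
proof -
  have "set_integrable lborel {0..1} (\<lambda>x. u x * trig q x)"
       "set_integrable lborel {0..1} (\<lambda>x. w x * trig q x)" for q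
    using assms unfolding orthogonal_to_trig_def
    by (intro set_integrable_continuous_01 continuous_intros; simp)+
  then show ?thesis
    using assms unfolding orthogonal_to_trig_def
    by (auto simp: distrib_right set_integral_add intro!: continuous_intros)
qed

lemma orthogonal_to_trig_cmult:
  assumes "orthogonal_to_trig u"
  shows "orthogonal_to_trig (\<lambda>x. c * u x)"
  using assms unfolding orthogonal_to_trig_def
  by (auto simp: mult.assoc intro!: continuous_intros)

lemma orthogonal_to_trig_trig:
  assumes "orthogonal_to_trig u"
  shows "orthogonal_to_trig (\<lambda>x. u x * trig p x)"
  using assms unfolding orthogonal_to_trig_def
  by (auto simp: mult.assoc intro!: continuous_intros simp flip: trig_add(1))

text \<open>
  On the unit circle Re w and Im w are combinations of w and w^{-1}, so
  multiplying by a linear form merely mixes shifted Fourier coefficients. Quantifying over the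
  function u is what makes the induction pass through products.
\<close>

lemma orthogonal_to_trig_polynomial:
  assumes "real_polynomial_function p" and "orthogonal_to_trig u"
  shows "orthogonal_to_trig (\<lambda>x. u x * of_real (p (trig 1 x)))"
  using assms
proof (induction arbitrary: u rule: real_polynomial_function.induct)
  case (linear f)
  define \<alpha> where "\<alpha> = (of_real (f 1) - \<i> * of_real (f \<i>)) / 2"
  define \<gamma> where "\<gamma> = (of_real (f 1) + \<i> * of_real (f \<i>)) / 2"
  have f: "f w = Re w * f 1 + Im w * f \<i>" for w
  proof -
    have "f w = f (Re w *\<^sub>R 1 + Im w *\<^sub>R \<i>)"
      by (rule arg_cong[of _ _ f]) (simp add: complex_eq_iff)
    also have "\<dots> = Re w * f 1 + Im w * f \<i>"
      using linear(1) by (simp add: linear_simps)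
    finally show ?thesis .
  qed
  have "u x * of_real (f (trig 1 x)) = \<alpha> * (u x * trig 1 x) + \<gamma> * (u x * trig (- 1) x)" for x
  proof -
    have "of_real (f (trig 1 x)) = \<alpha> * trig 1 x + \<gamma> * trig (- 1) x"
      unfolding f[of "trig 1 x"] \<alpha>_def \<gamma>_def by (simp add: trig_def complex_eq_iff field_simps)
    then show ?thesis by (simp add: algebra_simps)
  qed
  then show ?case
    using linear(2) by (simp only:) (intro orthogonal_to_trig_add orthogonal_to_trig_cmult orthogonal_to_trig_trig)
next
  case (const c)
  then show ?case using orthogonal_to_trig_cmult[of u "of_real c"] by (simp add: mult.commute)
next
  case (add f g)
  then show ?case using orthogonal_to_trig_add[OF add.IH(1)[OF add.prems] add.IH(2)[OF add.prems]]
    by (simp add: distrib_left)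
next
  case (mult f g)
  then show ?case using mult.IH(2)[OF mult.IH(1)[OF mult.prems]] by (simp add: mult.assoc)
qed

lemma trig_1_eq_iff: "trig 1 x = trig 1 y \<longleftrightarrow> (\<exists>m. x = y + of_int m)"
proof
  assume "trig 1 x = trig 1 y"
  then have "exp (\<i> * of_real (2 * pi * x)) = exp (\<i> * of_real (2 * pi * y))"
    by (simp add: trig_def cis_conv_exp)
  then obtain m :: int where "\<i> * of_real (2 * pi * x) = \<i> * of_real (2 * pi * y) + (of_int (2 * m) * pi) * \<i>"
    by (auto simp: exp_eq)
  then have "2 * pi * x = 2 * pi * y + 2 * of_int m * pi"
    by (simp add: complex_eq_iff)
  then have "(2 * pi) * x = (2 * pi) * (y + of_int m)" by (simp add: algebra_simps)
  then have "x = y + of_int m" by (subst (asm) mult_cancel_left) simp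
  then show "\<exists>m. x = y + of_int m" ..
qed (auto simp: trig_add)

text \<open>
  The winding map from [0,1] onto the circle is a continuous surjection from a compact space to
  a Hausdorff space, hence a quotient map, and h is constant on its fibres.
\<close>

lemma periodic_factors_through_circle:
  fixes h :: "real \<Rightarrow> real"
  assumes "continuous_on UNIV h" and per: "\<And>x m. h (x + of_int m) = h x"
  obtains g where "continuous_on (sphere 0 1) g" "\<And>x. x \<in> {0..1} \<Longrightarrow> g (trig 1 x) = h x"
proof -
  have img: "trig 1 ` {0..1} = sphere 0 1"
  proof (intro equalityI subsetI)
    fix w :: complex
    assume "w \<in> sphere 0 1"
    then obtain t where "0 \<le> t" "t < 2 * pi" "w = Complex (cos t) (sin t)"
      using complex_unimodular_polar[of w] by auto
    then have "t / (2 * pi) \<in> {0..1}" "w = trig 1 (t / (2 * pi))"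
      by (auto simp: trig_def field_simps complex_eq_iff)
    then show "w \<in> trig 1 ` {0..1}" by blast
  qed auto
  have q: "quotient_map (top_of_set {0..1::real}) (top_of_set (sphere 0 1)) (trig 1)"
  proof (rule T1_Spaces.continuous_imp_quotient_map)
    show "continuous_map (top_of_set {0..1}) (top_of_set (sphere 0 1)) (trig 1)"
      by (auto intro!: continuous_intros)
    show "compact_space (top_of_set {0..1::real})"
      by (simp add: compact_space_subtopology compactin_euclidean_iff)
    show "Hausdorff_space (top_of_set (sphere 0 1 :: complex set))"
      by (intro Hausdorff_space_subtopology Hausdorff_space_euclidean)
    show "trig 1 ` topspace (top_of_set {0..1}) = topspace (top_of_set (sphere 0 1))"
      using img by simp
  qed
  obtain g where "continuous_map (top_of_set (sphere 0 1)) euclidean g"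
    "\<And>x. x \<in> topspace (top_of_set {0..1}) \<Longrightarrow> g (trig 1 x) = h x"
  proof (rule quotient_map_lift_exists[OF q, of euclidean h])
    show "continuous_map (top_of_set {0..1}) euclidean h"
      using assms(1) by (auto intro: continuous_on_subset)
    show "h x = h y" if "trig 1 x = trig 1 y" for x y
      using that per by (auto simp: trig_1_eq_iff)
  qed auto
  then show ?thesis by (intro that[of g]) auto
qed

text \<open>
  By Stone--Weierstrass h is a uniform limit of polynomials in the point of the circle. Since h is
  orthogonal to all of these, \<integral>_0^1 h^2 is at most every positive
  multiple of \<integral>_0^1 |h|.
\<close>

lemma fourier_uniqueness:
  fixes h :: "real \<Rightarrow> real"
  assumes cont: "continuous_on UNIV h" and per: "\<And>x m. h (x + of_int m) = h x"
    and coef: "\<And>q. (LINT x:{0..1}|lborel. of_real (h x) * trig q x) = 0"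
  shows "h x = 0"
proof -
  obtain g where g: "continuous_on (sphere 0 1) g" "\<And>x. x \<in> {0..1} \<Longrightarrow> g (trig 1 x) = h x"
    using periodic_factors_through_circle[OF cont per] by blast
  define K where "K = (LINT x:{0..1}|lborel. \<bar>h x\<bar>)"
  define I where "I = (LINT x:{0..1}|lborel. (h x)\<^sup>2)"
  have nf: "orthogonal_to_trig (\<lambda>x. of_real (h x))"
    unfolding orthogonal_to_trig_def using coef by (auto intro!: continuous_intros cont)
  have int: "set_integrable lborel {0..1} (\<lambda>x. (h x)\<^sup>2)" "set_integrable lborel {0..1} (\<lambda>x. \<bar>h x\<bar>)"
    by (intro set_integrable_continuous_01 continuous_intros cont)+
  have bound: "I \<le> e * K" if "e > 0" for e
  proof -
    obtain p where p: "real_polynomial_function p" "\<And>w. w \<in> sphere 0 1 \<Longrightarrow> \<bar>g w - p w\<bar> < e"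
      using Stone_Weierstrass_real_polynomial_function[OF _ g(1) \<open>e > 0\<close>] by auto
    have pc: "continuous_on UNIV (\<lambda>x. p (trig 1 x))"
    proof -
      have "continuous_on UNIV p"
        using p(1) by (simp add: continuous_on_polymonial_function real_polynomial_function_eq)
      then show ?thesis by (rule continuous_on_compose2) (auto intro!: continuous_intros)
    qed
    have i2: "set_integrable lborel {0..1} (\<lambda>x. h x * p (trig 1 x))"
      by (intro set_integrable_continuous_01 continuous_intros cont pc)
    have "(LINT x:{0..1}|lborel. complex_of_real (h x * p (trig 1 x))) = 0"
      using orthogonal_to_trig_polynomial[OF p(1) nf] unfolding orthogonal_to_trig_def
      by (auto dest: spec[of _ 0])
    then have z: "(LINT x:{0..1}|lborel. h x * p (trig 1 x)) = 0"
      by (subst (asm) set_integral_complex_of_real) simp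
    have "I = (LINT x:{0..1}|lborel. (h x)\<^sup>2 - h x * p (trig 1 x))"
      unfolding I_def using set_integral_diff(2)[OF int(1) i2] z by simp
    also have "\<dots> \<le> (LINT x:{0..1}|lborel. e * \<bar>h x\<bar>)"
    proof (rule set_integral_mono)
      show "set_integrable lborel {0..1} (\<lambda>x. (h x)\<^sup>2 - h x * p (trig 1 x))"
        by (rule set_integral_diff(1)[OF int(1) i2])
      show "set_integrable lborel {0..1} (\<lambda>x. e * \<bar>h x\<bar>)"
        using int(2) by simp
      show "(h x)\<^sup>2 - h x * p (trig 1 x) \<le> e * \<bar>h x\<bar>" if "x \<in> {0..1}" for x
      proof -
        have "\<bar>h x - p (trig 1 x)\<bar> < e" using p(2)[of "trig 1 x"] g(2)[OF that] by simp
        then have "\<bar>h x\<bar> * \<bar>h x - p (trig 1 x)\<bar> \<le> \<bar>h x\<bar> * e"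
          by (intro mult_left_mono) auto
        moreover have "(h x)\<^sup>2 - h x * p (trig 1 x) \<le> \<bar>h x * (h x - p (trig 1 x))\<bar>"
          by (simp add: power2_eq_square algebra_simps)
        ultimately show ?thesis by (simp add: abs_mult mult.commute)
      qed
    qed
    also have "\<dots> = e * K" by (simp add: K_def)
    finally show ?thesis .
  qed
  have "K \<ge> 0" unfolding K_def set_lebesgue_integral_def by (intro integral_nonneg_AE) auto
  have "I \<le> 0"
  proof (rule field_le_epsilon)
    fix e :: real
    assume "e > 0"
    then have "I \<le> e / (K + 1) * K" using \<open>K \<ge> 0\<close> by (intro bound) auto
    also have "\<dots> \<le> e" using \<open>K \<ge> 0\<close> \<open>e > 0\<close> by (simp add: field_simps)
    finally show "I \<le> 0 + e" by simp
  qed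
  moreover have "I \<ge> 0" unfolding I_def set_lebesgue_integral_def by (intro integral_nonneg_AE) auto
  ultimately have "I = 0" by simp
  then have "integral {0..1} (\<lambda>x. (h x)\<^sup>2) = 0"
    using set_borel_integral_eq_integral(2)[OF int(1)] by (simp add: I_def)
  then have z: "\<forall>x\<in>{0..1}. (h x)\<^sup>2 = 0"
    by (subst (asm) integral_eq_0_iff)
       (auto intro!: continuous_intros continuous_on_subset[OF cont])
  have "h x = h (frac x + of_int \<lfloor>x\<rfloor>)" by (simp add: frac_def)
  also have "\<dots> = h (frac x)" by (rule per)
  also have "\<dots> = 0" using z frac_ge_0[of x] frac_lt_1[of x] by auto
  finally show ?thesis .
qed

section \<open>Unfolding and Poisson summation for the Gaussian\<close>

text \<open>
  The line is the disjoint union of the translates of [0,1) by integers. Splitting the integral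
  accordingly and moving each piece back by translation invariance gives
  \<integral>_{\<real>} g = \<Sum>_m \<integral>_{[0,1)} g(x + m), after which sum and integral are exchanged
  once more. The same lemma serves Lebesgue measure and the periodic measure \<nu>.
\<close>

lemma integral_unfold_periodic:
  fixes g :: "real \<Rightarrow> complex" and M :: "real measure"
  assumes sets: "sets M = sets borel"
    and inv: "\<And>m::int. distr M borel (\<lambda>x. x + of_int m) = M"
    and fin: "emeasure M {0..<1} < \<infinity>"
    and g [measurable]: "g \<in> borel_measurable borel"
    and bd: "\<And>m x. x \<in> {0..<1} \<Longrightarrow> norm (g (x + of_int m)) \<le> B m"
    and B: "B summable_on UNIV"
    and G: "\<And>x. x \<in> {0..<1} \<Longrightarrow> ((\<lambda>m. g (x + of_int m)) has_sum G x) UNIV"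
  shows "(LINT x|M. g x) = (LINT x:{0..<1}|M. G x)"
proof -
  have [measurable_cong]: "sets M = sets borel" by (rule sets)
  have sp: "space M = UNIV" using sets_eq_imp_space_eq[OF sets] by simp
  define F where "F m x = indicat_real {of_int m..<of_int m + 1} x *\<^sub>R g x" for m :: int and x
  define F' where "F' m x = indicat_real {0..<1} x *\<^sub>R g (x + of_int m)" for m :: int and x
  have [measurable]: "F m \<in> borel_measurable borel" "F' m \<in> borel_measurable borel" for m
    unfolding F_def F'_def by measurable
  have F': "F m (x + of_int m) = F' m x" for m x
    by (auto simp: F_def F'_def indicator_def)
  have B0: "0 \<le> B m" for m
    by (rule order_trans[OF norm_ge_zero bd[of 0 m]]) simp
  have intF': "integrable M (F' m)" for m
    unfolding F'_def
    by (rule integrableI_bounded_set_indicator[where B = "B m"])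
       (use fin bd in \<open>auto simp: sets intro!: AE_I2\<close>)
  have intF: "integrable M (F m)" for m
  proof -
    have "integrable (distr M borel (\<lambda>x. x + of_int m)) (F m)"
      by (subst integrable_distr_eq) (use intF' in \<open>simp_all add: F'\<close>)
    then show ?thesis by (simp add: inv)
  qed
  have transfer: "(LINT x|M. h (F m x)) = (LINT x|M. h (F' m x))"
    if [measurable]: "h \<in> borel_measurable borel" for h :: "complex \<Rightarrow> 'b::{banach, second_countable_topology}" and m
  proof -
    have "(LINT x|M. h (F m x)) = (LINT x|distr M borel (\<lambda>x. x + of_int m). h (F m x))"
      by (simp add: inv)
    also have "\<dots> = (LINT x|M. h (F m (x + of_int m)))"
      by (rule integral_distr) measurable
    finally show ?thesis by (simp add: F')
  qed
  have bound: "(LINT x|M. norm (F' m x)) \<le> B m * measure M {0..<1}" for m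
  proof -
    have "(LINT x|M. norm (F' m x)) \<le> (LINT x|M. indicat_real {0..<1} x * B m)"
    proof (rule integral_mono)
      show "integrable M (\<lambda>x. indicat_real {0..<1} x * B m)"
        using fin by (intro integrable_mult_left integrable_real_indicator) (simp_all add: sets)
      show "norm (F' m x) \<le> indicat_real {0..<1} x * B m" if "x \<in> space M" for x
        using bd[of x m] by (auto simp: F'_def indicator_def)
    qed (use intF' in auto)
    also have "\<dots> = B m * measure M {0..<1}" by (simp add: sp)
    finally show ?thesis .
  qed
  have summ: "(\<lambda>m. LINT x|M. norm (F' m x)) summable_on UNIV"
    by (rule summable_on_comparison_test[OF summable_on_cmult_left[OF B]]) (use bound in auto)
  have summF: "(\<lambda>m. LINT x|M. norm (F m x)) summable_on UNIV"
    using summ by (simp add: transfer[of norm])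
  have only: "F m x = 0" if "m \<noteq> \<lfloor>x\<rfloor>" for m x
    using that by (auto simp: F_def indicator_def) linarith
  have hsF: "((\<lambda>m. F m x) has_sum g x) UNIV" for x
  proof (rule has_sum_finite_neutralI[of "{\<lfloor>x\<rfloor>}"])
    have "F \<lfloor>x\<rfloor> x = g x" by (auto simp: F_def indicator_def) 
    then show "g x = (\<Sum>m\<in>{\<lfloor>x\<rfloor>}. F m x)" by simp
  qed (use only in auto)
  have absF: "(\<lambda>m. norm (F m x)) summable_on UNIV" for x
  proof (rule finite_nonzero_values_imp_summable_on)
    have "{m \<in> UNIV. norm (F m x) \<noteq> 0} \<subseteq> {\<lfloor>x\<rfloor>}" using only by auto
    then show "finite {m \<in> UNIV. norm (F m x) \<noteq> 0}" by (rule finite_subset) simp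
  qed
  have hsF': "((\<lambda>m. F' m x) has_sum indicat_real {0..<1} x *\<^sub>R G x) UNIV" for x
    using G[of x] unfolding F'_def by (cases "x \<in> {0..<1}") (auto simp: indicator_def)
  have absF': "(\<lambda>m. norm (F' m x)) summable_on UNIV" for x
    by (rule summable_on_comparison_test[OF B]) (use bd[of x] B0 in \<open>auto simp: F'_def indicator_def\<close>)
  have 1: "((\<lambda>m. LINT x|M. F m x) has_sum (LINT x|M. g x)) UNIV"
    by (rule integral_has_sum_int(2)[OF intF summF hsF absF])
  have 2: "((\<lambda>m. LINT x|M. F' m x) has_sum (LINT x:{0..<1}|M. G x)) UNIV"
    unfolding set_lebesgue_integral_def by (rule integral_has_sum_int(2)[OF intF' summ hsF' absF'])
  have "(\<lambda>m. LINT x|M. F m x) = (\<lambda>m. LINT x|M. F' m x)"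
    using transfer[of "\<lambda>z. z"] by simp
  with 1 have "((\<lambda>m. LINT x|M. F' m x) has_sum (LINT x|M. g x)) UNIV"
    by simp
  then show ?thesis using 2 by (rule has_sum_unique)
qed

lemma translation_invariant_int:
  fixes M :: "real measure"
  assumes sets: "sets M = sets borel" and inv: "distr M borel (\<lambda>x. x + 1) = M"
  shows "distr M borel (\<lambda>x. x + of_int m) = M"
proof -
  have [measurable_cong]: "sets M = sets borel" by (rule sets)
  have id: "distr M borel (\<lambda>x. x) = M"
    by (rule distr_id2) (simp add: sets)
  have nat: "distr M borel (\<lambda>x. x + real n) = M" for n
  proof (induction n)
    case (Suc n)
    have "distr M borel (\<lambda>x. x + real (Suc n)) = distr (distr M borel (\<lambda>x. x + real n)) borel (\<lambda>x. x + 1)"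
      by (subst distr_distr) (auto simp: o_def add_ac)
    then show ?case by (simp add: Suc.IH inv)
  qed (simp add: id)
  show ?thesis
  proof (cases m rule: int_cases2)
    case (nonneg n)
    then show ?thesis using nat[of n] by simp
  next
    case (nonpos n)
    have "distr M borel (\<lambda>x. x - real n) = distr (distr M borel (\<lambda>x. x + real n)) borel (\<lambda>x. x - real n)"
      by (simp add: nat)
    also have "\<dots> = M"
      by (subst distr_distr) (auto simp: o_def id)
    finally show ?thesis using nonpos by simp
  qed
qed

lemma normal_law_integral:
  fixes f :: "real \<Rightarrow> 'b::{banach, second_countable_topology}"
  assumes [measurable]: "f \<in> borel_measurable borel"
  shows "(LINT x|normal_law s. f x) = (LINT x|lborel. normal_density 0 (sqrt s) x *\<^sub>R f x)"
  unfolding normal_law_def by (rule integral_density) auto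

text \<open>
  The characteristic function of the standard normal law, rescaled.
\<close>

lemma normal_law_trig:
  assumes s: "s > 0"
  shows "(LINT x|normal_law s. trig q x) = of_real (exp (- 2 * pi\<^sup>2 * (of_int q)\<^sup>2 * s))"
proof -
  define t where "t = 2 * pi * of_int q * sqrt s"
  have "(LINT x|normal_law s. trig q x) = (LINT x|lborel. normal_density 0 (sqrt s) x *\<^sub>R trig q x)"
    by (rule normal_law_integral) measurable
  also have "\<dots> = \<bar>sqrt s\<bar> *\<^sub>R (LINT x|lborel. normal_density 0 (sqrt s) (0 + sqrt s * x) *\<^sub>R trig q (0 + sqrt s * x))"
    by (rule lborel_integral_real_affine) (use s in simp)
  also have "\<dots> = (LINT x|lborel. sqrt s *\<^sub>R (normal_density 0 (sqrt s) (0 + sqrt s * x) *\<^sub>R trig q (0 + sqrt s * x)))"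
    using s by (simp only: scaleR_conv_of_real integral_mult_right_zero real_sqrt_abs2 abs_of_nonneg real_sqrt_ge_zero less_imp_le)
  also have "\<dots> = (LINT x|lborel. std_normal_density x *\<^sub>R cis (t * x))"
  proof (rule Bochner_Integration.integral_cong[OF refl])
    fix x
    have "sqrt s * normal_density 0 (sqrt s) (sqrt s * x) = std_normal_density x"
      using s by (simp add: normal_density_def power_mult_distrib real_sqrt_mult field_simps)
    moreover have "trig q (sqrt s * x) = cis (t * x)"
      by (simp add: trig_def t_def mult_ac)
    ultimately show "sqrt s *\<^sub>R (normal_density 0 (sqrt s) (0 + sqrt s * x) *\<^sub>R trig q (0 + sqrt s * x))
        = std_normal_density x *\<^sub>R cis (t * x)"
      by simp
  qed
  also have "\<dots> = char std_normal_distribution t"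
    unfolding char_def by (subst integral_density) (auto simp: cis_conv_exp mult_ac)
  also have "\<dots> = of_real (exp (- (t^2) / 2))"
    by (simp add: char_std_normal_distribution)
  also have "- (t^2) / 2 = - 2 * pi\<^sup>2 * (of_int q)\<^sup>2 * s"
    using s by (simp add: t_def power_mult_distrib)
  finally show ?thesis .
qed

lemma gaussian_fourier_transform:
  assumes c: "c > 0"
  shows "(LINT x|lborel. of_real (exp (- c * x\<^sup>2)) * trig q x)
    = of_real (sqrt (pi / c) * exp (- pi\<^sup>2 * (of_int q)\<^sup>2 / c))"
proof -
  define s where "s = 1 / (2 * c)"
  have s: "s > 0" using c by (simp add: s_def)
  have d: "exp (- c * x\<^sup>2) = sqrt (pi / c) * normal_density 0 (sqrt s) x" for x
  proof -
    have "2 * pi * (sqrt s)\<^sup>2 = pi / c" "(x - 0)\<^sup>2 / (2 * (sqrt s)\<^sup>2) = c * x\<^sup>2"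
      using s c by (simp_all add: s_def real_sqrt_pow2)
    then have "normal_density 0 (sqrt s) x = 1 / sqrt (pi / c) * exp (- (c * x\<^sup>2))"
      unfolding normal_density_def minus_divide_left [symmetric] by (simp only:)
    then show ?thesis using c by simp
  qed
  have "(LINT x|lborel. of_real (exp (- c * x\<^sup>2)) * trig q x)
     = (LINT x|lborel. of_real (sqrt (pi / c)) * (normal_density 0 (sqrt s) x *\<^sub>R trig q x))"
    unfolding d by (simp add: scaleR_conv_of_real mult_ac)
  also have "\<dots> = of_real (sqrt (pi / c)) * (LINT x|normal_law s. trig q x)"
    unfolding normal_law_integral[OF measurable_trig] by (rule integral_mult_right_zero)
  also have "\<dots> = of_real (sqrt (pi / c) * exp (- pi\<^sup>2 * (of_int q)\<^sup>2 / c))"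
    unfolding normal_law_trig[OF s] using c by (simp add: s_def)
  finally show ?thesis .
qed

text \<open>
  Since (x + m)^2 + x^2 - m^2/2 = 2(x + m/2)^2 \<ge> 0, the shifted Gaussians are dominated,
  uniformly for x in a bounded set, by a summable Gaussian in m.
\<close>

lemma gaussian_shift_bound:
  fixes x :: real
  assumes "c > 0" and "\<bar>x\<bar> \<le> R"
  shows "exp (- c * (x + m)\<^sup>2) \<le> exp (c * R\<^sup>2) * exp (- (c / 2) * m\<^sup>2)"
proof -
  have "(x + m)\<^sup>2 + x\<^sup>2 - m\<^sup>2 / 2 = 2 * (x + m / 2)\<^sup>2" by (simp add: power2_eq_square field_simps)
  then have "m\<^sup>2 / 2 - x\<^sup>2 \<le> (x + m)\<^sup>2" by (smt (verit) zero_le_power2)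
  moreover have "x\<^sup>2 \<le> R\<^sup>2" using assms(2) by (intro abs_le_square_iff[THEN iffD1]) auto
  ultimately have "m\<^sup>2 / 2 - R\<^sup>2 \<le> (x + m)\<^sup>2" by linarith
  then have "c * (m\<^sup>2 / 2 - R\<^sup>2) \<le> c * (x + m)\<^sup>2" using assms(1) by (intro mult_left_mono) auto
  then show ?thesis by (simp add: algebra_simps flip: exp_add)
qed

definition periodized_gaussian :: "real \<Rightarrow> real \<Rightarrow> real" where
  "periodized_gaussian c x = (\<Sum>\<^sub>\<infinity>m::int. exp (- c * (x + of_int m)\<^sup>2))"

lemma summable_gaussian_bound:
  fixes c K :: real
  assumes "c > 0"
  shows "(\<lambda>m::int. K * exp (- (c / 2) * (of_int m)\<^sup>2)) summable_on UNIV"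
  using summable_on_exp_quadratic[of "c / 2" 0] assms by (intro summable_on_cmult_right) simp

lemma periodized_gaussian_has_sum:
  assumes c: "c > 0"
  shows "((\<lambda>m::int. exp (- c * (x + of_int m)\<^sup>2)) has_sum periodized_gaussian c x) UNIV"
  unfolding periodized_gaussian_def
  by (intro has_sum_infsum summable_on_comparison_test[OF summable_gaussian_bound[OF c, of "exp (c * \<bar>x\<bar>\<^sup>2)"]])
     (use gaussian_shift_bound[OF c, of x "\<bar>x\<bar>"] in auto)

lemma continuous_periodized_gaussian:
  assumes c: "c > 0"
  shows "continuous_on UNIV (periodized_gaussian c)"
proof -
  have "continuous_on {-R<..<R} (periodized_gaussian c)" for R
    by (rule continuous_on_has_sum[OF _ _ summable_gaussian_bound[OF c, of "exp (c * R\<^sup>2)"]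
        periodized_gaussian_has_sum[OF c]])
       (use gaussian_shift_bound[OF c, of _ R] in \<open>auto intro!: continuous_intros\<close>)
  then have "continuous_on (\<Union>R. {-R<..<R}) (periodized_gaussian c)"
    by (intro continuous_on_open_UN) auto
  moreover have "(\<Union>R. {-R<..<R}) = (UNIV :: real set)"
  proof -
    have "x \<in> {- (\<bar>x\<bar> + 1)<..<\<bar>x\<bar> + 1}" for x :: real by auto
    then show ?thesis by blast
  qed
  ultimately show ?thesis by simp
qed

lemma periodized_gaussian_periodic:
  "periodized_gaussian c (x + of_int k) = periodized_gaussian c x"
  unfolding periodized_gaussian_def
  using infsum_shift[of "\<lambda>m::int. exp (- c * (x + of_int m)\<^sup>2)" k]
  by (simp add: add_ac)

text \<open>
  The Fourier coefficients of functions are taken over the closed unit interval, whereas unfolding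
  needs a half-open fundamental domain; for Lebesgue measure the endpoint is negligible.
\<close>

lemma set_integral_Icc_Ico:
  "(LINT x:{0..1}|lborel. f x) = (LINT x:{0..<1::real}|lborel. (f x :: complex))"
  if [measurable]: "f \<in> borel_measurable borel"
  unfolding set_lebesgue_integral_def
proof (rule integral_cong_AE)
  show "AE x in lborel. indicat_real {0..1} x *\<^sub>R f x = indicat_real {0..<1} x *\<^sub>R f x"
    using AE_lborel_singleton[of 1] by eventually_elim (auto simp: indicator_def)
qed measurable

text \<open>
  By unfolding, the q-th Fourier coefficient of the periodized Gaussian is the Fourier transform
  of the Gaussian at q. The series with these coefficients is a continuous periodic function with the same
  Fourier coefficients, so uniqueness identifies the two.
\<close>

lemma poisson_summation_gaussian:
  assumes c: "c > 0"
  shows "fourier_series (\<lambda>q. sqrt (pi / c) * exp (- pi\<^sup>2 * (of_int q)\<^sup>2 / c)) (periodized_gaussian c)"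
proof -
  define A where "A q = sqrt (pi / c) * exp (- pi\<^sup>2 * (of_int q)\<^sup>2 / c)" for q :: int
  have "A summable_on UNIV"
    using summable_on_exp_quadratic[of "pi\<^sup>2 / c" 0] c unfolding A_def
    by (intro summable_on_cmult_right) simp
  then obtain f where f: "fourier_series A f"
    using fourier_series_exists[of A] c by (auto simp: A_def)
  have contH: "continuous_on UNIV (periodized_gaussian c)" by (rule continuous_periodized_gaussian[OF c])
  have [measurable]: "periodized_gaussian c \<in> borel_measurable borel"
    by (rule borel_measurable_continuous_onI[OF contH])
  have coefH: "(LINT x:{0..1}|lborel. of_real (periodized_gaussian c x) * trig q x) = of_real (A q)" for q
  proof -
    have "(LINT x:{0..1}|lborel. of_real (periodized_gaussian c x) * trig q x)
      = (LINT x:{0..<1}|lborel. of_real (periodized_gaussian c x) * trig q x)"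
      by (rule set_integral_Icc_Ico) measurable
    also have "\<dots> = (LINT x|lborel. of_real (exp (- c * x\<^sup>2)) * trig q x)"
    proof (rule integral_unfold_periodic[symmetric])
      show "distr lborel borel (\<lambda>x::real. x + of_int m) = lborel" for m
      proof -
        have "(\<lambda>x. x + real_of_int m) = (+) (of_int m)" by (simp add: fun_eq_iff)
        then show ?thesis by (simp add: lborel_distr_plus)
      qed
      show "norm (of_real (exp (- c * (x + of_int m)\<^sup>2)) * trig q (x + of_int m))
          \<le> exp c * exp (- (c / 2) * (of_int m)\<^sup>2)" if "x \<in> {0..<1}" for m x
        using gaussian_shift_bound[OF c, of x 1 "of_int m"] that by (simp add: norm_mult)
      show "(\<lambda>m::int. exp c * exp (- (c / 2) * (of_int m)\<^sup>2)) summable_on UNIV"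
        by (rule summable_gaussian_bound[OF c])
      show "((\<lambda>m. of_real (exp (- c * (x + of_int m)\<^sup>2)) * trig q (x + of_int m)) has_sum
          of_real (periodized_gaussian c x) * trig q x) UNIV" for x
        unfolding trig_add trig_of_int mult_1_right
        by (intro has_sum_cmult_left has_sum_of_real periodized_gaussian_has_sum c)
    qed auto
    finally show ?thesis unfolding gaussian_fourier_transform[OF c] A_def .
  qed
  have contf: "continuous_on UNIV f" by (rule fourier_series_continuous[OF f])
  have coeff: "(LINT x:{0..1}|lborel. of_real (f x) * trig q x) = of_real (A q)" for q
    using fourier_series_coefficient[OF f, of "- q"] fourier_seriesD(2)[OF f, of q] by simp
  have "periodized_gaussian c x - f x = 0" for x
  proof (rule fourier_uniqueness[of "\<lambda>x. periodized_gaussian c x - f x"])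
    show "continuous_on UNIV (\<lambda>x. periodized_gaussian c x - f x)"
      by (intro continuous_intros contH contf)
    show "periodized_gaussian c (x + of_int m) - f (x + of_int m) = periodized_gaussian c x - f x"
      for x m
      by (simp add: periodized_gaussian_periodic fourier_series_periodic[OF f])
    show "(LINT x:{0..1}|lborel. complex_of_real (periodized_gaussian c x - f x) * trig q x) = 0" for q
    proof -
      have "set_integrable lborel {0..1} (\<lambda>x. of_real (periodized_gaussian c x) * trig q x)"
        "set_integrable lborel {0..1} (\<lambda>x. of_real (f x) * trig q x)"
        by (intro set_integrable_continuous_01 continuous_intros contH contf)+
      then have "(LINT x:{0..1}|lborel. of_real (periodized_gaussian c x) * trig q x - of_real (f x) * trig q x)
        = of_real (A q) - of_real (A q)"
        by (simp add: set_integral_diff coefH coeff)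
      then show ?thesis by (simp add: left_diff_distrib)
    qed
  qed
  then have "periodized_gaussian c = f" by auto
  then show ?thesis using f unfolding A_def by simp
qed

text \<open>
  Every point is within distance 1 of an integer, and one term of the sum is enough.
\<close>

lemma periodized_gaussian_lower_bound:
  assumes c: "c > 0"
  shows "exp (- c) \<le> periodized_gaussian c x"
proof -
  define m where "m = - \<lfloor>x\<rfloor>"
  have "0 \<le> x + of_int m" "x + of_int m \<le> 1" unfolding m_def by linarith+
  then have "(x + of_int m)\<^sup>2 \<le> 1" by (simp add: power_le_one_iff abs_square_le_1)
  then have "exp (- c) \<le> exp (- c * (x + of_int m)\<^sup>2)" using c by simp
  also have "\<dots> = (\<Sum>m\<in>{m}. exp (- c * (x + of_int m)\<^sup>2))" by simp
  also have "\<dots> \<le> periodized_gaussian c x"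
    by (rule finite_sum_le_has_sum[OF periodized_gaussian_has_sum[OF c]]) auto
  finally show ?thesis .
qed

section \<open>Gaussian averages\<close>

lemma fourier_series_gaussian_average:
  assumes P: "fourier_series P h" and s: "s > 0"
  shows "fourier_series (\<lambda>q. exp (- 2 * pi\<^sup>2 * (of_int q)\<^sup>2 * s) * P q) (\<lambda>z. LINT \<zeta>|normal_law s. h (z + \<zeta>))"
proof -
  interpret prob_space "normal_law s"
    unfolding normal_law_def using s by (intro prob_space_normal_density) simp
  have [measurable_cong]: "sets (normal_law s) = sets borel" by (simp add: normal_law_def)
  define A where "A q = exp (- 2 * pi\<^sup>2 * (of_int q)\<^sup>2 * s) * P q" for q :: int
  have absP: "\<bar>P q\<bar> = P q" for q using fourier_seriesD(1)[OF P, of q] by simp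
  have "A summable_on UNIV"
  proof (rule summable_on_comparison_test[OF fourier_seriesD(3)[OF P]])
    show "A q \<le> P q" "0 \<le> A q" for q
      using fourier_seriesD(1)[OF P, of q] s by (simp_all add: A_def mult_left_le_one_le)
  qed
  moreover have "((\<lambda>q. of_real (A q) * trig q z) has_sum of_real (LINT \<zeta>|normal_law s. h (z + \<zeta>))) UNIV" for z
  proof -
    let ?F = "\<lambda>q \<zeta>. complex_of_real (P q) * trig q (z + \<zeta>)"
    have "((\<lambda>q. LINT \<zeta>|normal_law s. ?F q \<zeta>) has_sum (LINT \<zeta>|normal_law s. complex_of_real (h (z + \<zeta>)))) UNIV"
    proof (rule integral_has_sum_int(2))
      show "integrable (normal_law s) (?F q)" for q
        by (rule integrable_const_bound[where B = "P q"]) (auto simp: norm_mult absP)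
      show "(\<lambda>q. LINT \<zeta>|normal_law s. norm (?F q \<zeta>)) summable_on UNIV"
        using fourier_seriesD(3)[OF P] by (simp add: norm_mult absP prob_space)
    qed (rule fourier_seriesD[OF P])+
    moreover have "(LINT \<zeta>|normal_law s. ?F q \<zeta>) = of_real (A q) * trig q z" for q
    proof -
      have "(LINT \<zeta>|normal_law s. ?F q \<zeta>) = (LINT \<zeta>|normal_law s. (of_real (P q) * trig q z) * trig q \<zeta>)"
        by (simp add: trig_add mult_ac)
      also have "\<dots> = of_real (P q) * trig q z * (LINT \<zeta>|normal_law s. trig q \<zeta>)"
        by (rule integral_mult_right_zero)
      also have "\<dots> = of_real (A q) * trig q z"
        unfolding normal_law_trig[OF s] A_def by simp
      finally show ?thesis .
    qed
    ultimately show ?thesis by simp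
  qed
  ultimately show ?thesis
    using fourier_seriesD(1,2)[OF P] unfolding fourier_series_def A_def by simp
qed

text \<open>
  The density is at least its value at 1 on all of [0,1], and the integral of the periodic
  function over this interval is its zeroth coefficient P(0), which Gaussian averaging leaves
  unchanged. The bound is thus relative to the mean, whatever the shape of h.
\<close>

lemma gaussian_average_lower_bound:
  assumes P: "fourier_series P h" and h: "\<And>x. 0 \<le> h x" and s: "s > 0"
  shows "normal_density 0 (sqrt s) 1 * P 0 \<le> (LINT \<zeta>|normal_law s. h (z + \<zeta>))"
proof -
  interpret prob_space "normal_law s"
    unfolding normal_law_def using s by (intro prob_space_normal_density) simp
  have cont: "continuous_on UNIV h" by (rule fourier_series_continuous[OF P])
  then have cont': "continuous_on UNIV (\<lambda>\<zeta>. h (z + \<zeta>))"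
    by (rule continuous_on_compose2) (auto intro!: continuous_intros)
  have [measurable]: "(\<lambda>\<zeta>. h (z + \<zeta>)) \<in> borel_measurable borel"
    by (rule borel_measurable_continuous_onI[OF cont'])
  have "integrable (normal_law s) (\<lambda>\<zeta>. h (z + \<zeta>))"
    by (rule integrable_const_bound[where B = "infsum P UNIV"])
       (auto simp: normal_law_def fourier_series_bound[OF P])
  then have int: "integrable lborel (\<lambda>\<zeta>. normal_density 0 (sqrt s) \<zeta> *\<^sub>R h (z + \<zeta>))"
    unfolding normal_law_def by (subst (asm) integrable_density) auto
  have "normal_density 0 (sqrt s) 1 * P 0
      = (LINT \<zeta>|lborel. normal_density 0 (sqrt s) 1 * (indicat_real {0..1} \<zeta> *\<^sub>R h (z + \<zeta>)))"
    using fourier_series_mean[OF P, of z] by (simp add: set_lebesgue_integral_def)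
  also have "\<dots> \<le> (LINT \<zeta>|lborel. normal_density 0 (sqrt s) \<zeta> *\<^sub>R h (z + \<zeta>))"
  proof (rule integral_mono)
    show "integrable lborel (\<lambda>\<zeta>. normal_density 0 (sqrt s) 1 * (indicat_real {0..1} \<zeta> *\<^sub>R h (z + \<zeta>)))"
      using set_integrable_continuous_01[OF cont'] by (simp add: set_integrable_def)
    show "normal_density 0 (sqrt s) 1 * (indicat_real {0..1} \<zeta> *\<^sub>R h (z + \<zeta>))
        \<le> normal_density 0 (sqrt s) \<zeta> *\<^sub>R h (z + \<zeta>)" for \<zeta>
    proof (cases "\<zeta> \<in> {0..1}")
      case True
      then have "\<zeta>\<^sup>2 \<le> 1\<^sup>2" by (intro power_mono) auto
      then have "normal_density 0 (sqrt s) 1 \<le> normal_density 0 (sqrt s) \<zeta>"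
        using s by (auto simp: normal_density_def divide_right_mono)
      then show ?thesis using True h by (simp add: mult_right_mono)
    qed (simp add: h)
  qed (rule int)
  also have "\<dots> = (LINT \<zeta>|normal_law s. h (z + \<zeta>))"
    by (rule normal_law_integral[symmetric]) measurable
  finally show ?thesis .
qed

section \<open>The periodic measure and the initial function\<close>

lemma fourier_coeff_trig: "fourier_coeff \<nu> q = (LINT x:{0..<1}|\<nu>. trig (- q) x)"
proof -
  have "exp (- (2 * complex_of_real pi * \<i> * of_int q * complex_of_real z)) = trig (- q) z" for z
    by (simp add: trig_def cis_conv_exp mult_ac)
  then show ?thesis by (simp add: fourier_coeff_def)
qed

lemma assumption_B_unit_interval_finite:
  assumes "assumption_B \<nu>"
  shows "sets \<nu> = sets borel" and "emeasure \<nu> {0..<1} < \<infinity>"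
proof -
  show sets: "sets \<nu> = sets borel"
    using assms by (simp add: assumption_B_def radon_measure_on_line_def)
  have "emeasure \<nu> {0..<1} \<le> emeasure \<nu> {0..1}"
    by (rule emeasure_mono) (auto simp: sets)
  also have "\<dots> < \<infinity>"
    using assms compact_Icc by (simp add: assumption_B_def radon_measure_on_line_def)
  finally show "emeasure \<nu> {0..<1} < \<infinity>" .
qed

lemma fourier_coeff_0:
  assumes "assumption_B \<nu>"
  shows "Re (fourier_coeff \<nu> 0) = measure \<nu> {0..<1}"
proof -
  have "space \<nu> = UNIV"
    using sets_eq_imp_space_eq[OF assumption_B_unit_interval_finite(1)[OF assms]] by simp
  then have "fourier_coeff \<nu> 0 = of_real (measure \<nu> {0..<1})"
    by (simp add: fourier_coeff_trig set_lebesgue_integral_def scaleR_conv_of_real)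
  then show ?thesis by simp
qed

text \<open>
  Unfolding turns the integral over the line into one of the periodized Gaussian over a single
  period. The statement is in the complex numbers because unfolding and termwise integration are applied
  to complex-valued functions.
\<close>

lemma integral_gaussian_periodic_measure:
  assumes B: "assumption_B \<nu>" and c: "c > 0"
  shows "complex_of_real (LINT \<zeta>|\<nu>. exp (- c * (z - \<zeta>)\<^sup>2))
    = (LINT x:{0..<1}|\<nu>. of_real (periodized_gaussian c (z - x)))"
proof -
  note sets = assumption_B_unit_interval_finite[OF B]
  have "complex_of_real (LINT \<zeta>|\<nu>. exp (- c * (z - \<zeta>)\<^sup>2)) = (LINT \<zeta>|\<nu>. of_real (exp (- c * (z - \<zeta>)\<^sup>2)))"
    by simp
  also have "\<dots> = (LINT x:{0..<1}|\<nu>. of_real (periodized_gaussian c (z - x)))"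
  proof (rule integral_unfold_periodic)
    show "distr \<nu> borel (\<lambda>x. x + of_int m) = \<nu>" for m
      using B sets by (intro translation_invariant_int) (auto simp: assumption_B_def)
    have eq: "(z - (x + of_int m))\<^sup>2 = ((x - z) + of_int m)\<^sup>2" for x m
      by (simp add: power2_eq_square algebra_simps)
    show "norm (complex_of_real (exp (- c * (z - (x + of_int m))\<^sup>2)))
        \<le> exp (c * (\<bar>z\<bar> + 1)\<^sup>2) * exp (- (c / 2) * (of_int m)\<^sup>2)" if "x \<in> {0..<1}" for m x
    proof -
      have "\<bar>x - z\<bar> \<le> \<bar>z\<bar> + 1" using that by auto
      from gaussian_shift_bound[OF c this, of "of_int m"] show ?thesis by (simp add: eq)
    qed
    show "(\<lambda>m::int. exp (c * (\<bar>z\<bar> + 1)\<^sup>2) * exp (- (c / 2) * (of_int m)\<^sup>2)) summable_on UNIV"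
      by (rule summable_gaussian_bound[OF c])
    show "((\<lambda>m. complex_of_real (exp (- c * (z - (x + of_int m))\<^sup>2))) has_sum
        of_real (periodized_gaussian c (z - x))) UNIV" for x
      using periodized_gaussian_has_sum[OF c, of "x - z"]
        fourier_series_even[OF poisson_summation_gaussian[OF c], of "x - z"]
      by (intro has_sum_of_real) (simp add: eq)
  qed (use sets in auto)
  finally show ?thesis .
qed

text \<open>
  Expand the periodized Gaussian by Poisson summation and integrate termwise: the convolution with
  \<nu> multiplies the Fourier coefficients.
\<close>

lemma initial_fourier_series:
  assumes B: "assumption_B \<nu>" and c: "c > 0"
  shows "fourier_series (\<lambda>q. sqrt (pi / c) * exp (- pi\<^sup>2 * (of_int q)\<^sup>2 / c) * Re (fourier_coeff \<nu> q))
      (\<lambda>z. LINT \<zeta>|\<nu>. exp (- c * (z - \<zeta>)\<^sup>2))"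
proof -
  note sets = assumption_B_unit_interval_finite[OF B]
  have [measurable_cong]: "sets \<nu> = sets borel" by (rule sets)
  have sp: "space \<nu> = UNIV" using sets_eq_imp_space_eq[OF sets(1)] by simp
  define t where "t q = sqrt (pi / c) * exp (- pi\<^sup>2 * (of_int q)\<^sup>2 / c)" for q :: int
  define a where "a q = Re (fourier_coeff \<nu> q)" for q
  have T: "fourier_series t (periodized_gaussian c)"
    unfolding t_def by (rule poisson_summation_gaussian[OF c])
  have abst: "\<bar>t q\<bar> = t q" for q using fourier_seriesD(1)[OF T, of q] by simp
  have a: "0 < a q" "a (- q) = a q" "complex_of_real (a q) = fourier_coeff \<nu> q" for q
    using B by (auto simp: assumption_B_def a_def of_real_Re)
  \<comment> \<open>Boundedness of the coefficients of the measure gives summability of the product.\<close>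
  have ale: "a q \<le> measure \<nu> {0..<1}" for q
  proof -
    have "a q = norm (fourier_coeff \<nu> q)"
      using a(1)[of q] by (simp flip: a(3))
    also have "\<dots> \<le> (LINT x|\<nu>. norm (indicat_real {0..<1} x *\<^sub>R trig (- q) x))"
      unfolding fourier_coeff_trig set_lebesgue_integral_def by (rule integral_norm_bound)
    also have "\<dots> = measure \<nu> {0..<1}" by (simp add: sp)
    finally show ?thesis .
  qed
  have summ: "(\<lambda>q. t q * a q) summable_on UNIV"
    by (rule summable_on_comparison_test[OF summable_on_cmult_left[OF fourier_seriesD(3)[OF T], of "measure \<nu> {0..<1}"]])
       (use ale a(1) fourier_seriesD(1)[OF T] in \<open>auto intro!: mult_left_mono mult_nonneg_nonneg less_imp_le\<close>)
  have hs: "((\<lambda>q. of_real (t q * a q) * trig q z) has_sum of_real (LINT \<zeta>|\<nu>. exp (- c * (z - \<zeta>)\<^sup>2))) UNIV" for z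
  proof -
    let ?F = "\<lambda>q x. indicat_real {0..<1} x *\<^sub>R (complex_of_real (t q) * trig q (z - x))"
    have "((\<lambda>q. LINT x|\<nu>. ?F q x) has_sum (LINT x:{0..<1}|\<nu>. of_real (periodized_gaussian c (z - x)))) UNIV"
      unfolding set_lebesgue_integral_def
    proof (rule integral_has_sum_int(2))
      show "integrable \<nu> (?F q)" for q
        by (rule integrableI_bounded_set_indicator[where B = "t q"])
           (use sets abst in \<open>auto simp: norm_mult\<close>)
      show "(\<lambda>q. LINT x|\<nu>. norm (?F q x)) summable_on UNIV"
      proof -
        have "(LINT x|\<nu>. norm (?F q x)) = measure \<nu> {0..<1} * t q" for q
          by (simp add: norm_mult abst sp)
        then show ?thesis by (simp add: summable_on_cmult_right[OF fourier_seriesD(3)[OF T]])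
      qed
      show "((\<lambda>q. ?F q x) has_sum indicat_real {0..<1} x *\<^sub>R of_real (periodized_gaussian c (z - x))) UNIV" for x
        by (intro has_sum_scaleR fourier_seriesD(4)[OF T])
      show "(\<lambda>q. norm (?F q x)) summable_on UNIV" for x
        using summable_on_cmult_right[OF fourier_seriesD(3)[OF T], of "indicat_real {0..<1} x"]
        by (simp add: norm_mult abst)
    qed
    moreover have "(LINT x|\<nu>. ?F q x) = of_real (t q * a q) * trig q z" for q
    proof -
      have "?F q x = (of_real (t q) * trig q z) * (indicat_real {0..<1} x *\<^sub>R trig (- q) x)" for x
      proof -
        have "trig q (z - x) = trig q z * trig (- q) x"
          by (simp add: trig_def cis_mult algebra_simps)
        then show ?thesis by simp
      qed
      then have "(LINT x|\<nu>. ?F q x) = (of_real (t q) * trig q z) * (LINT x:{0..<1}|\<nu>. trig (- q) x)"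
        unfolding set_lebesgue_integral_def by (simp only: integral_mult_right_zero)
      then show ?thesis by (simp add: a(3) flip: fourier_coeff_trig)
    qed
    ultimately show ?thesis
      unfolding integral_gaussian_periodic_measure[OF B c] by simp
  qed
  show ?thesis
    unfolding fourier_series_def t_def [symmetric] a_def [symmetric]
    using hs summ a fourier_seriesD(1,2)[OF T] by auto
qed

lemma initial_lower_bound:
  assumes B: "assumption_B \<nu>" and c: "c > 0"
  shows "exp (- c) * Re (fourier_coeff \<nu> 0) \<le> (LINT \<zeta>|\<nu>. exp (- c * (z - \<zeta>)\<^sup>2))"
proof -
  note sets = assumption_B_unit_interval_finite[OF B]
  have sp: "space \<nu> = UNIV" using sets_eq_imp_space_eq[OF sets(1)] by simp
  have [measurable_cong]: "sets \<nu> = sets borel" by (rule sets)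
  have T: "fourier_series (\<lambda>q. sqrt (pi / c) * exp (- pi\<^sup>2 * (of_int q)\<^sup>2 / c)) (periodized_gaussian c)"
    by (rule poisson_summation_gaussian[OF c])
  have [measurable]: "periodized_gaussian c \<in> borel_measurable borel"
    by (rule borel_measurable_continuous_onI[OF continuous_periodized_gaussian[OF c]])
  have int: "set_integrable \<nu> {0..<1} (\<lambda>x. periodized_gaussian c (z - x))"
    unfolding set_integrable_def
    by (rule integrableI_bounded_set_indicator)
       (use sets in \<open>auto intro!: AE_I2 fourier_series_bound[OF T]\<close>)
  have "exp (- c) * Re (fourier_coeff \<nu> 0) = (LINT x:{0..<1}|\<nu>. exp (- c))"
    by (simp add: fourier_coeff_0[OF B] set_lebesgue_integral_def sp)
  also have "\<dots> \<le> (LINT x:{0..<1}|\<nu>. periodized_gaussian c (z - x))"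
    by (rule set_integral_mono[OF _ int])
       (use sets periodized_gaussian_lower_bound[OF c] in \<open>auto simp: set_integrable_def\<close>)
  also have "\<dots> = (LINT \<zeta>|\<nu>. exp (- c * (z - \<zeta>)\<^sup>2))"
  proof -
    have "complex_of_real (LINT x:{0..<1}|\<nu>. periodized_gaussian c (z - x)) = of_real (LINT \<zeta>|\<nu>. exp (- c * (z - \<zeta>)\<^sup>2))"
      unfolding integral_gaussian_periodic_measure[OF B c]
      by (rule set_integral_complex_of_real[symmetric])
    then show ?thesis by simp
  qed
  finally show ?thesis .
qed

section \<open>Smoothness and derivative bounds\<close>

lemma Re_holomorphic_has_real_derivative:
  assumes W: "W holomorphic_on S" "open S" "complex_of_real x \<in> S"
  shows "((\<lambda>x. Re (W (of_real x))) has_real_derivative Re (deriv W (of_real x))) (at x)"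
proof -
  have "(W has_field_derivative deriv W (of_real x)) (at (of_real x))"
    using W by (rule holomorphic_derivI)
  then have "((\<lambda>x. W (of_real x)) has_vector_derivative deriv W (of_real x)) (at x)"
    by (rule has_vector_derivative_real_field)
  then have "((\<lambda>x. Re (W (of_real x))) has_vector_derivative Re (deriv W (of_real x))) (at x)"
    by (rule bounded_linear.has_vector_derivative[OF bounded_linear_Re])
  then show ?thesis by (simp add: has_real_derivative_iff_has_vector_derivative)
qed

lemma iterated_deriv_Re_holomorphic:
  assumes V: "V holomorphic_on S" "open S" "\<And>x. complex_of_real x \<in> S"
  shows "(deriv ^^ m) (\<lambda>x. Re (V (of_real x))) = (\<lambda>x. Re ((deriv ^^ m) V (of_real x)))"
proof (induction m)
  case (Suc m)
  have "(deriv ^^ m) V holomorphic_on S" using V by (intro holomorphic_higher_deriv)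
  then have "deriv (\<lambda>x. Re ((deriv ^^ m) V (of_real x))) x = Re (deriv ((deriv ^^ m) V) (of_real x))" for x
    by (rule DERIV_imp_deriv[OF Re_holomorphic_has_real_derivative[OF _ V(2,3)]])
  then show ?case by (simp only: funpow.simps o_apply Suc.IH)
qed simp

text \<open>
  Real derivatives of all orders exist because they are restrictions of the complex ones.
\<close>

lemma smooth_real_Re_holomorphic:
  assumes V: "V holomorphic_on S" "open S" "\<And>x. complex_of_real x \<in> S"
  shows "smooth_real (\<lambda>x. Re (V (of_real x)))"
  unfolding smooth_real_def
proof (intro allI)
  fix m x
  have "(deriv ^^ m) V holomorphic_on S" using V by (intro holomorphic_higher_deriv)
  from Re_holomorphic_has_real_derivative[OF this V(2,3)]
  show "(deriv ^^ m) (\<lambda>x. Re (V (of_real x))) differentiable (at x)"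
    unfolding iterated_deriv_Re_holomorphic[OF V] real_differentiable_def by blast
qed

definition ctrig :: "int \<Rightarrow> complex \<Rightarrow> complex" where
  "ctrig q w = exp (2 * of_real pi * \<i> * of_int q * w)"

lemma ctrig_of_real: "ctrig q (of_real x) = trig q x"
  by (simp add: ctrig_def trig_def cis_conv_exp mult_ac)

lemma norm_ctrig_le:
  assumes "\<bar>Im w\<bar> \<le> R"
  shows "norm (ctrig q w) \<le> exp (2 * pi * R * \<bar>of_int q\<bar>)"
proof -
  have "- (of_int q * Im w) \<le> \<bar>of_int q * Im w\<bar>" by linarith
  also have "\<dots> \<le> \<bar>of_int q\<bar> * R" using assms by (simp add: abs_mult mult_left_mono)
  finally have "2 * pi * (- (of_int q * Im w)) \<le> 2 * pi * (\<bar>of_int q\<bar> * R)"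
    by (intro mult_left_mono) auto
  moreover have "norm (ctrig q w) = exp (2 * pi * (- (of_int q * Im w)))"
    by (simp add: ctrig_def)
  ultimately show ?thesis by (simp only: exp_le_cancel_iff mult_ac)
qed

text \<open>
  Gaussian decay of the coefficients beats the growth e^{2\<pi> |q| |Im w|} of the
  characters on every strip, so the series converges locally uniformly in the whole plane.
\<close>

lemma entire_fourier_series:
  assumes A0: "\<And>q. 0 \<le> A q" and e: "e > 0"
    and A: "\<And>q::int. A q \<le> K * exp (- e * (of_int q)\<^sup>2)"
  obtains F where "F holomorphic_on UNIV"
    "\<And>w. ((\<lambda>q. of_real (A q) * ctrig q w) has_sum F w) UNIV"
proof -
  let ?t = "\<lambda>q w. complex_of_real (A q) * ctrig q w"
  let ?B = "\<lambda>R q. K * exp (- e * (of_int q)\<^sup>2 + 2 * pi * R * \<bar>of_int q\<bar>)"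
  have s: "?B R summable_on UNIV" for R
    by (intro summable_on_cmult_right summable_on_exp_quadratic e)
  have K: "0 \<le> K" using A0[of 0] A[of 0] by simp
  have bd: "norm (?t q w) \<le> ?B R q" if "\<bar>Im w\<bar> \<le> R" for q w R
  proof -
    have "norm (?t q w) = A q * norm (ctrig q w)" using A0 by (simp add: norm_mult)
    also have "\<dots> \<le> (K * exp (- e * (of_int q)\<^sup>2)) * exp (2 * pi * R * \<bar>of_int q\<bar>)"
      by (intro mult_mono A norm_ctrig_le that) (use K in auto)
    also have "\<dots> = ?B R q" by (simp only: exp_add mult.assoc)
    finally show ?thesis .
  qed
  define F where "F w = (\<Sum>\<^sub>\<infinity>q. ?t q w)" for w
  have abs: "(\<lambda>q. norm (?t q w)) summable_on UNIV" for w
    by (rule summable_on_comparison_test[OF s[of "\<bar>Im w\<bar>"] bd[OF order_refl] norm_ge_zero])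
  have hs: "((\<lambda>q. ?t q w) has_sum F w) UNIV" for w
    unfolding F_def by (rule has_sum_infsum[OF abs_summable_summable[OF abs]])
  have diff: "?t (int_decode n) field_differentiable at w" for n w
  proof -
    have "(ctrig q has_field_derivative ctrig q w * (2 * of_real pi * \<i> * of_int q)) (at w)" for q
      unfolding ctrig_def by (auto intro!: derivative_eq_intros)
    then show ?thesis
      by (intro field_differentiable_mult field_differentiable_const) (auto simp: field_differentiable_def)
  qed
  have dom: "\<exists>d h. 0 < d \<and> summable h \<and> range h \<subseteq> \<real>\<^sub>\<ge>\<^sub>0 \<and>
      (\<forall>\<^sub>F n in sequentially. \<forall>y\<in>ball x d \<inter> UNIV. cmod (?t (int_decode n) y) \<le> cmod (h n))" for x
  proof -
    define h where "h n = ?B (\<bar>Im x\<bar> + 1) (int_decode n)" for n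
    have h0: "0 \<le> h n" for n using K by (simp add: h_def)
    have "h summable_on UNIV"
      unfolding h_def using s[of "\<bar>Im x\<bar> + 1"]
      by (subst summable_on_reindex_bij_betw[OF bij_int_decode, of "?B (\<bar>Im x\<bar> + 1)"])
    then have "summable h" by (rule summable_on_imp_summable)
    then have "summable (\<lambda>n. complex_of_real (h n))" by (rule summable_of_real)
    moreover have "range (\<lambda>n. complex_of_real (h n)) \<subseteq> \<real>\<^sub>\<ge>\<^sub>0"
      using h0 by auto
    moreover have "cmod (?t (int_decode n) y) \<le> cmod (complex_of_real (h n))" if "y \<in> ball x 1" for n y
    proof -
      have "\<bar>Im (y - x)\<bar> \<le> 1"
        using that abs_Im_le_cmod[of "y - x"] by (simp add: dist_norm norm_minus_commute)
      then have "\<bar>Im y\<bar> \<le> \<bar>Im x\<bar> + 1" by simp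
      from bd[OF this, of "int_decode n"] show ?thesis
        unfolding norm_of_real h_def by (rule order_trans[OF _ abs_ge_self])
    qed
    ultimately show ?thesis
      by (intro exI[of _ 1] exI[of _ "\<lambda>n. complex_of_real (h n)"]) simp
  qed
  obtain g where g: "\<forall>w\<in>UNIV. ((\<lambda>n. ?t (int_decode n) w) sums g w) \<and> g field_differentiable (at w)"
    by (rule series_differentiable_comparison_complex[of UNIV "\<lambda>n. ?t (int_decode n)", OF open_UNIV diff dom])
  have "F = g"
  proof
    fix w
    have "((\<lambda>n. ?t (int_decode n) w) has_sum F w) UNIV"
      using hs[of w] has_sum_reindex_bij_betw[OF bij_int_decode, of "\<lambda>q. ?t q w"] by simp
    then have "(\<lambda>n. ?t (int_decode n) w) sums F w" by (rule has_sum_imp_sums)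
    moreover have "(\<lambda>n. ?t (int_decode n) w) sums g w" using g by blast
    ultimately show "F w = g w" by (rule sums_unique2)
  qed
  then have "F holomorphic_on UNIV"
    using g by (simp add: holomorphic_on_def field_differentiable_at_within)
  then show ?thesis using hs by (rule that)
qed

text \<open>
  Only the terms with q \<noteq> 0 contribute to the difference, and for these k|q| \<ge> k yields
  the uniform factor e^{-ek}, while q^2 still makes the series converge on the strip.
\<close>

lemma fourier_series_perturbation_bound:
  assumes hs: "((\<lambda>q. of_real (A q) * ctrig q w) has_sum F) UNIV"
    and A0: "\<And>q. 0 \<le> A q" and e: "e > 0" and C: "C \<ge> 0" 
    and A: "\<And>q. A q \<le> A 0 * (C * exp (- e * (real k * \<bar>of_int q\<bar> + (of_int q)\<^sup>2)))"
    and w: "\<bar>Im w\<bar> \<le> 1"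
  shows "norm (F - of_real (A 0))
    \<le> A 0 * (C * (\<Sum>\<^sub>\<infinity>q::int. exp (- e * (of_int q)\<^sup>2 + 2 * pi * \<bar>of_int q\<bar>)) * exp (- e * real k))"
proof -
  let ?E = "\<lambda>q::int. exp (- e * (of_int q)\<^sup>2 + 2 * pi * \<bar>of_int q\<bar>)"
  have z: "((\<lambda>q::int. if q = 0 then - complex_of_real (A 0) else 0) has_sum - of_real (A 0)) UNIV"
    by (rule has_sum_finite_neutralI[of "{0}"]) auto
  have d: "((\<lambda>q. of_real (A q) * ctrig q w + (if q = 0 then - of_real (A 0) else 0)) has_sum F - of_real (A 0)) UNIV"
    using has_sum_add[OF hs z] by simp
  have E: "((\<lambda>q. A 0 * (C * exp (- e * real k)) * ?E q) has_sum
      A 0 * (C * exp (- e * real k)) * infsum ?E UNIV) UNIV"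
    by (intro has_sum_cmult_right has_sum_infsum summable_on_exp_quadratic e)
  have "norm (F - of_real (A 0)) \<le> A 0 * (C * exp (- e * real k)) * infsum ?E UNIV"
  proof (rule norm_infsum_le[OF d E])
    fix q :: int
    show "norm (of_real (A q) * ctrig q w + (if q = 0 then - of_real (A 0) else 0))
        \<le> A 0 * (C * exp (- e * real k)) * ?E q"
    proof (cases "q = 0")
      case True
      then show ?thesis using A0[of 0] C by (simp add: ctrig_def)
    next
      case False
      then have q1: "1 \<le> \<bar>real_of_int q\<bar>" by linarith
      have "e * real k * 1 \<le> e * real k * \<bar>of_int q\<bar>"
        using e q1 by (intro mult_left_mono) auto
      then have "- e * (real k * \<bar>of_int q\<bar> + (of_int q)\<^sup>2) \<le> - e * real k + (- e * (of_int q)\<^sup>2)"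
        by (simp add: algebra_simps)
      then have "exp (- e * (real k * \<bar>of_int q\<bar> + (of_int q)\<^sup>2)) \<le> exp (- e * real k) * exp (- e * (of_int q)\<^sup>2)"
        by (simp only: exp_le_cancel_iff flip: exp_add)
      then have "A 0 * (C * exp (- e * (real k * \<bar>of_int q\<bar> + (of_int q)\<^sup>2)))
          \<le> A 0 * (C * (exp (- e * real k) * exp (- e * (of_int q)\<^sup>2)))"
        using A0[of 0] C by (intro mult_left_mono)
      then have "A q \<le> A 0 * (C * (exp (- e * real k) * exp (- e * (of_int q)\<^sup>2)))"
        using A[of q] by linarith
      moreover have "norm (ctrig q w) \<le> exp (2 * pi * \<bar>of_int q\<bar>)"
        using norm_ctrig_le[OF w, of q] by simp
      ultimately have "A q * norm (ctrig q w)
          \<le> A 0 * (C * (exp (- e * real k) * exp (- e * (of_int q)\<^sup>2))) * exp (2 * pi * \<bar>of_int q\<bar>)"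
        by (intro mult_mono) (use A0[of 0] C in auto)
      also have "\<dots> = A 0 * (C * exp (- e * real k)) * ?E q"
        by (simp only: exp_add mult_ac)
      finally show ?thesis using False A0[of q] by (simp add: norm_mult)
    qed
  qed
  then show ?thesis by (simp only: mult_ac)
qed

text \<open>
  Extend f to an entire function F. Cauchy's inequalities on unit discs centred at real points
  bound F' and F'' there by multiples of A(0) e^{-ek}. The function V = -Ln F is
  holomorphic where Re F > 0, an open set containing the real line, and extends
  -ln f; the lower bound on f controls the quotients in V' = -F'/F and
  V'' = -F''/F + (F'/F)^2.
\<close>

lemma log_fourier_series_smooth_and_flat:
  assumes f: "fourier_series A f" and e: "e > 0" and C: "C \<ge> 0" and m: "m > 0"
    and A: "\<And>q. A q \<le> A 0 * (C * exp (- e * (real k * \<bar>of_int q\<bar> + (of_int q)\<^sup>2)))"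
    and low: "\<And>x. m * A 0 \<le> f x"
  defines "D \<equiv> C * (\<Sum>\<^sub>\<infinity>q::int. exp (- e * (of_int q)\<^sup>2 + 2 * pi * \<bar>of_int q\<bar>))"
  shows "smooth_real (\<lambda>x. - ln (f x))"
    and "(\<lambda>x. - ln (f x)) differentiable (at x)"
    and "\<bar>deriv (\<lambda>x. - ln (f x)) x\<bar> \<le> D / m * exp (- e * real k)"
    and "\<bar>deriv (deriv (\<lambda>x. - ln (f x))) x\<bar> \<le> (2 * D / m + (D / m)\<^sup>2) * exp (- e * real k)"
proof -
  have Apos: "0 < A q" for q by (rule fourier_seriesD(1)[OF f])
  have fpos: "0 < f x" for x using low[of x] Apos[of 0] m by (meson less_le_trans mult_pos_pos)
  have gauss: "A q \<le> (A 0 * C) * exp (- e * (of_int q)\<^sup>2)" for q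
  proof -
    have "- e * (real k * \<bar>of_int q\<bar> + (of_int q)\<^sup>2) \<le> - e * (of_int q)\<^sup>2" using e by simp
    then have "A 0 * (C * exp (- e * (real k * \<bar>of_int q\<bar> + (of_int q)\<^sup>2))) \<le> A 0 * (C * exp (- e * (of_int q)\<^sup>2))"
      using C less_imp_le[OF Apos[of 0]] by (intro mult_left_mono) (simp_all only: exp_le_cancel_iff)
    then show ?thesis using A[of q] by (simp add: mult.assoc)
  qed
  obtain F where F: "F holomorphic_on UNIV"
    and hs: "\<And>w. ((\<lambda>q. of_real (A q) * ctrig q w) has_sum F w) UNIV"
    using entire_fourier_series[of A e "A 0 * C", OF less_imp_le[OF Apos] e gauss] by metis
  have Fx: "F (of_real x) = of_real (f x)" for x
    using hs[of "of_real x"] fourier_seriesD(4)[OF f, of x] unfolding ctrig_of_real by (rule has_sum_unique)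
  define \<epsilon> where "\<epsilon> = D * exp (- e * real k)"
  have near: "norm (F w - of_real (A 0)) \<le> A 0 * \<epsilon>" if "\<bar>Im w\<bar> \<le> 1" for w
    using fourier_series_perturbation_bound[OF hs less_imp_le[OF Apos] e C A that]
    by (simp add: \<epsilon>_def D_def)
  have D0: "0 \<le> D" unfolding D_def using C by (intro mult_nonneg_nonneg infsum_nonneg) auto
  \<comment> \<open>The constant term is removed first: its derivatives vanish, and the rest is of order exp(-ek).\<close>
  have Cauchy: "norm ((deriv ^^ n) (\<lambda>w. F w - of_real (A 0)) (of_real x)) \<le> fact n * (A 0 * \<epsilon>) / 1 ^ n" for n x
  proof (rule Cauchy_inequality)
    show "(\<lambda>w. F w - of_real (A 0)) holomorphic_on ball (of_real x) 1"
      by (intro holomorphic_intros holomorphic_on_subset[OF F]) auto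
    show "continuous_on (cball (of_real x) 1) (\<lambda>w. F w - of_real (A 0))"
      by (intro holomorphic_on_imp_continuous_on holomorphic_intros holomorphic_on_subset[OF F]) auto
    show "norm (F w - of_real (A 0)) \<le> A 0 * \<epsilon>" if "norm (of_real x - w) = 1" for w
    proof (rule near)
      show "\<bar>Im w\<bar> \<le> 1" using abs_Im_le_cmod[of "of_real x - w"] that by simp
    qed
  qed simp
  have dF: "deriv (\<lambda>w. F w - of_real (A 0)) = deriv F"
  proof
    fix w
    have "F field_differentiable at w" using F by (auto simp: holomorphic_on_def)
    then show "deriv (\<lambda>w. F w - of_real (A 0)) w = deriv F w" by simp
  qed
  have F1: "norm (deriv F (of_real x)) \<le> A 0 * \<epsilon>" for x
    using Cauchy[of 1 x] by (simp add: dF)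
  have F2: "norm (deriv (deriv F) (of_real x)) \<le> 2 * (A 0 * \<epsilon>)" for x
    using Cauchy[of 2 x] by (simp add: numeral_2_eq_2 dF)
  have F': "deriv F holomorphic_on UNIV" using F by (intro holomorphic_deriv) auto
  have Fd: "(F has_field_derivative deriv F w) (at w)" "(deriv F has_field_derivative deriv (deriv F) w) (at w)" for w
    using holomorphic_derivI[OF F] holomorphic_derivI[OF F'] by auto
  define S where "S = {w. 0 < Re (F w)}"
  have "continuous_on UNIV (\<lambda>w. Re (F w))"
    by (intro continuous_on_Re holomorphic_on_imp_continuous_on F)
  then have S: "open S" unfolding S_def
    using open_Collect_less[of "\<lambda>_. 0" "\<lambda>w. Re (F w)"] by (simp add: continuous_on_const)
  have xS: "of_real x \<in> S" for x using fpos by (simp add: S_def Fx)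
  have nz: "F w \<notin> \<real>\<^sub>\<le>\<^sub>0" "F w \<noteq> 0" if "w \<in> S" for w
    using that by (auto simp: S_def complex_nonpos_Reals_iff)
  define V where "V w = - Ln (F w)" for w
  have dV: "(V has_field_derivative - (deriv F w / F w)) (at w)" if "w \<in> S" for w
    unfolding V_def using nz[OF that] by (auto intro!: derivative_eq_intros Fd simp: divide_inverse mult.commute)
  have hV: "V holomorphic_on S"
    using dV S by (auto simp: holomorphic_on_open)
  have V: "(\<lambda>x. - ln (f x)) = (\<lambda>x. Re (V (of_real x)))"
    using fpos by (simp add: V_def Fx Ln_of_real fun_eq_iff)
  show "smooth_real (\<lambda>x. - ln (f x))"
    unfolding V by (rule smooth_real_Re_holomorphic[OF hV S xS])
  then show "(\<lambda>x. - ln (f x)) differentiable (at x)"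
    unfolding smooth_real_def by (metis funpow_0)
  have V1: "deriv V w = - (deriv F w / F w)" if "w \<in> S" for w
    by (rule DERIV_imp_deriv[OF dV[OF that]])
  have V2: "deriv (deriv V) w = - (deriv (deriv F) w / F w) + (deriv F w / F w)\<^sup>2" if w: "w \<in> S" for w
  proof (rule DERIV_imp_deriv)
    have "((\<lambda>w. - (deriv F w / F w)) has_field_derivative
        - (deriv (deriv F) w / F w) + (deriv F w / F w)\<^sup>2) (at w)"
      using nz(2)[OF w] by (auto intro!: derivative_eq_intros Fd simp: field_simps power2_eq_square)
    then show "(deriv V has_field_derivative - (deriv (deriv F) w / F w) + (deriv F w / F w)\<^sup>2) (at w)"
      by (rule has_field_derivative_transform_within_open[OF _ S w]) (simp add: V1)
  qed
  have eps: "0 \<le> \<epsilon>" using D0 by (simp add: \<epsilon>_def)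
  have Fn: "m * A 0 \<le> norm (F (of_real x))" for x
    using low[of x] fpos[of x] by (simp add: Fx)
  have mA: "0 < m * A 0" using m Apos by simp
  have Ae: "0 \<le> A 0 * \<epsilon>" using eps Apos[of 0] by simp
  have q1: "norm (deriv F (of_real x) / F (of_real x)) \<le> \<epsilon> / m" for x
  proof -
    have "norm (deriv F (of_real x) / F (of_real x)) \<le> (A 0 * \<epsilon>) / (m * A 0)"
      unfolding norm_divide by (intro frac_le F1 Fn mA Ae)
    then show ?thesis using Apos[of 0] by simp
  qed
  have q2: "norm (deriv (deriv F) (of_real x) / F (of_real x)) \<le> 2 * \<epsilon> / m" for x
  proof -
    have "norm (deriv (deriv F) (of_real x) / F (of_real x)) \<le> (2 * (A 0 * \<epsilon>)) / (m * A 0)"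
      unfolding norm_divide by (intro frac_le F2 Fn mA mult_nonneg_nonneg Ae) simp
    then show ?thesis using Apos[of 0] by simp
  qed
  have "deriv (\<lambda>x. - ln (f x)) x = Re (deriv V (of_real x))"
    unfolding V using iterated_deriv_Re_holomorphic[OF hV S xS, of 1] by (simp add: fun_eq_iff)
  then have "\<bar>deriv (\<lambda>x. - ln (f x)) x\<bar> \<le> norm (deriv V (of_real x))"
    by (simp add: abs_Re_le_cmod)
  also have "\<dots> \<le> \<epsilon> / m" using q1[of x] by (simp add: V1[OF xS])
  finally show "\<bar>deriv (\<lambda>x. - ln (f x)) x\<bar> \<le> D / m * exp (- e * real k)"
    by (simp add: \<epsilon>_def)
  have "deriv (deriv (\<lambda>x. - ln (f x))) x = Re (deriv (deriv V) (of_real x))"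
    unfolding V using iterated_deriv_Re_holomorphic[OF hV S xS, of 2] by (simp add: fun_eq_iff numeral_2_eq_2)
  then have "\<bar>deriv (deriv (\<lambda>x. - ln (f x))) x\<bar> \<le> norm (deriv (deriv V) (of_real x))"
    by (simp add: abs_Re_le_cmod)
  also have "\<dots> \<le> norm (deriv (deriv F) (of_real x) / F (of_real x)) + (norm (deriv F (of_real x) / F (of_real x)))\<^sup>2"
    unfolding V2[OF xS]
    by (rule order_trans[OF norm_triangle_ineq]) (simp only: norm_minus_cancel norm_power order_refl)
  also have "\<dots> \<le> 2 * \<epsilon> / m + (\<epsilon> / m)\<^sup>2"
    by (intro add_mono power_mono q1 q2) auto
  also have "(\<epsilon> / m)\<^sup>2 \<le> (D / m)\<^sup>2 * exp (- e * real k)"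
  proof -
    have "exp (- e * real k) \<le> 1" using e by simp
    then have "exp (- e * real k) * exp (- e * real k) \<le> exp (- e * real k)"
      by (intro mult_left_le) auto
    then have "(D / m)\<^sup>2 * (exp (- e * real k) * exp (- e * real k)) \<le> (D / m)\<^sup>2 * exp (- e * real k)"
      by (intro mult_left_mono) auto
    then show ?thesis by (simp add: \<epsilon>_def power2_eq_square mult_ac)
  qed
  finally show "\<bar>deriv (deriv (\<lambda>x. - ln (f x))) x\<bar> \<le> (2 * D / m + (D / m)\<^sup>2) * exp (- e * real k)"
    by (simp add: \<epsilon>_def algebra_simps)
qed

section \<open>The recursion for the Fourier coefficients\<close>

text \<open>
  Compared with ratio_bounded this keeps the factor e^{-4\<pi>^2 s q} which a Gaussian average of
  variance s contributes to the quotient at q (since (q+1)^2 - q^2 = 2q + 1; the remaining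
  e^{-2\<pi>^2 s} is absorbed in c). The product of these factors is the source of the Gaussian
  decay in q.
\<close>

definition gaussian_ratio :: "(int \<Rightarrow> real) \<Rightarrow> real \<Rightarrow> real \<Rightarrow> bool" where
  "gaussian_ratio A c s \<longleftrightarrow> (\<forall>q\<ge>0. A (q + 1) \<le> exp (- 4 * pi\<^sup>2 * s * of_int q) * (c * A q))"

lemma gaussian_ratio_imp_ratio_bounded:
  assumes "gaussian_ratio A c s" and A: "\<And>q. 0 < A q" and "0 \<le> c" and "0 < s"
  shows "ratio_bounded A c"
  unfolding ratio_bounded_def
proof (intro allI impI)
  fix q :: int
  assume q: "0 \<le> q"
  then have "A (q + 1) \<le> exp (- 4 * pi\<^sup>2 * s * of_int q) * (c * A q)"
    using assms(1) by (simp add: gaussian_ratio_def)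
  also have "\<dots> \<le> c * A q"
    using q assms(3,4) A[of q] by (intro mult_left_le_one_le) auto
  finally show "A (q + 1) \<le> c * A q" .
qed

lemma gaussian_ratio_gaussian_mult:
  assumes P: "ratio_bounded P c"
  shows "gaussian_ratio (\<lambda>q. exp (- 2 * pi\<^sup>2 * (of_int q)\<^sup>2 * s) * P q) (exp (- 2 * pi\<^sup>2 * s) * c) s"
  unfolding gaussian_ratio_def
proof (intro allI impI)
  fix q :: int
  assume "0 \<le> q"
  then have "P (q + 1) \<le> c * P q" using P by (simp add: ratio_bounded_def)
  then have "exp (- 2 * pi\<^sup>2 * (of_int (q + 1))\<^sup>2 * s) * P (q + 1) \<le> exp (- 2 * pi\<^sup>2 * (of_int (q + 1))\<^sup>2 * s) * (c * P q)"
    by (intro mult_left_mono) auto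
  moreover have "exp (- 2 * pi\<^sup>2 * (of_int (q + 1))\<^sup>2 * s)
      = exp (- 4 * pi\<^sup>2 * s * of_int q) * (exp (- 2 * pi\<^sup>2 * s) * exp (- 2 * pi\<^sup>2 * (of_int q)\<^sup>2 * s))"
    unfolding exp_add [symmetric] by (simp add: power2_eq_square algebra_simps)
  ultimately show "exp (- 2 * pi\<^sup>2 * (of_int (q + 1))\<^sup>2 * s) * P (q + 1)
      \<le> exp (- 4 * pi\<^sup>2 * s * of_int q) * (exp (- 2 * pi\<^sup>2 * s) * c * (exp (- 2 * pi\<^sup>2 * (of_int q)\<^sup>2 * s) * P q))"
    by (simp only: mult_ac)
qed

lemma gaussian_ratio_decay_nat:
  assumes "gaussian_ratio A c s" and "0 \<le> A 0" and "0 \<le> c"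
  shows "A (int q) \<le> exp (- 2 * pi\<^sup>2 * s * ((real q)\<^sup>2 - real q)) * c ^ q * A 0"
proof (induction q)
  case (Suc q)
  have "A (int (Suc q)) \<le> exp (- 4 * pi\<^sup>2 * s * real q) * (c * A (int q))"
    using assms(1)[unfolded gaussian_ratio_def, rule_format, of "int q"] by (simp add: add.commute)
  also have "\<dots> \<le> exp (- 4 * pi\<^sup>2 * s * real q) * (c * (exp (- 2 * pi\<^sup>2 * s * ((real q)\<^sup>2 - real q)) * c ^ q * A 0))"
    using Suc.IH assms(3) by (intro mult_left_mono) auto
  also have "\<dots> = exp (- 4 * pi\<^sup>2 * s * real q + - 2 * pi\<^sup>2 * s * ((real q)\<^sup>2 - real q)) * c ^ Suc q * A 0"
    by (simp only: exp_add power_Suc mult_ac)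
  also have "- 4 * pi\<^sup>2 * s * real q + - 2 * pi\<^sup>2 * s * ((real q)\<^sup>2 - real q)
      = - 2 * pi\<^sup>2 * s * ((real (Suc q))\<^sup>2 - real (Suc q))"
    by (simp add: power2_eq_square algebra_simps)
  finally show ?case .
qed (use assms in simp)

text \<open>
  With \<rho> = \<pi>^2\<sigma> the product of the quotients is at most
  exp(-2\<rho>(n^2 - n) + n ln K - \<kappa> k n) for n = |q|. Half of the quadratic term absorbs
  everything linear in n that does not involve k, which produces the constant; the other half
  and \<kappa> k n give the decay.
\<close>

lemma gaussian_ratio_decay:
  assumes ratio: "gaussian_ratio A c s" and A: "\<And>q. 0 < A q" and even: "\<And>q. A (- q) = A q"
    and c: "0 \<le> c" "c \<le> K * exp (- \<kappa> * real k)" and K: "0 < K"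
    and s: "\<sigma> \<le> s" and \<sigma>: "0 < \<sigma>" and e: "e \<le> pi\<^sup>2 * \<sigma>" "e \<le> \<kappa>"
  shows "A q \<le> A 0 * (exp ((2 * pi\<^sup>2 * \<sigma> + ln K)\<^sup>2 / (4 * (pi\<^sup>2 * \<sigma>)))
      * exp (- e * (real k * \<bar>of_int q\<bar> + (of_int q)\<^sup>2)))"
proof -
  define \<rho> where "\<rho> = pi\<^sup>2 * \<sigma>"
  have \<rho>: "0 < \<rho>" using \<sigma> by (simp add: \<rho>_def)
  define n where "n = nat \<bar>q\<bar>"
  have n: "real n = \<bar>of_int q\<bar>" "(of_int q)\<^sup>2 = (real n)\<^sup>2" by (simp_all add: n_def)
  have "A q = A (int n)" unfolding n_def using even[of q] by (cases "q \<ge> 0") auto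
  also have "\<dots> \<le> exp (- 2 * pi\<^sup>2 * s * ((real n)\<^sup>2 - real n)) * c ^ n * A 0"
    using gaussian_ratio_decay_nat[OF ratio _ c(1)] A[of 0] by simp
  also have "\<dots> \<le> exp (- 2 * \<rho> * ((real n)\<^sup>2 - real n)) * (exp (real n * (ln K + - \<kappa> * real k))) * A 0"
  proof -
    have "real n \<le> (real n)\<^sup>2" by (cases n) (simp_all add: power2_eq_square algebra_simps)
    then have "2 * pi\<^sup>2 * \<sigma> * ((real n)\<^sup>2 - real n) \<le> 2 * pi\<^sup>2 * s * ((real n)\<^sup>2 - real n)"
      using s by (intro mult_right_mono mult_left_mono) auto
    then have 1: "exp (- 2 * pi\<^sup>2 * s * ((real n)\<^sup>2 - real n)) \<le> exp (- 2 * \<rho> * ((real n)\<^sup>2 - real n))"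
      by (simp add: \<rho>_def)
    have "c ^ n \<le> (K * exp (- \<kappa> * real k)) ^ n" by (rule power_mono[OF c(2,1)])
    also have "\<dots> = exp (real n * (ln K + - \<kappa> * real k))"
      unfolding exp_of_nat_mult exp_add using K by simp
    finally have 2: "c ^ n \<le> exp (real n * (ln K + - \<kappa> * real k))" .
    show ?thesis by (intro mult_right_mono mult_mono 1 2) (use c A[of 0] in auto)
  qed
  also have "\<dots> = exp (- 2 * \<rho> * ((real n)\<^sup>2 - real n) + real n * (ln K + - \<kappa> * real k)) * A 0"
    by (simp only: exp_add)
  also have "\<dots> \<le> exp ((2 * \<rho> + ln K)\<^sup>2 / (4 * \<rho>) + - e * (real k * real n + (real n)\<^sup>2)) * A 0"
  proof -
    have 1: "- \<rho> * (real n)\<^sup>2 + (2 * \<rho> + ln K) * real n \<le> (2 * \<rho> + ln K)\<^sup>2 / (4 * \<rho>)"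
      by (rule quadratic_upper_bound[OF \<rho>])
    have 2: "e * (real n)\<^sup>2 \<le> \<rho> * (real n)\<^sup>2" using e by (intro mult_right_mono) (auto simp: \<rho>_def)
    have 3: "e * (real k * real n) \<le> \<kappa> * (real k * real n)" using e by (intro mult_right_mono) auto
    have "- 2 * \<rho> * ((real n)\<^sup>2 - real n) + real n * (ln K + - \<kappa> * real k)
      = (- \<rho> * (real n)\<^sup>2 + (2 * \<rho> + ln K) * real n) - \<rho> * (real n)\<^sup>2 - \<kappa> * (real k * real n)"
      by (simp add: algebra_simps)
    also have "\<dots> \<le> (2 * \<rho> + ln K)\<^sup>2 / (4 * \<rho>) - e * (real n)\<^sup>2 - e * (real k * real n)"
      using 1 2 3 by linarith
    also have "\<dots> = (2 * \<rho> + ln K)\<^sup>2 / (4 * \<rho>) + - e * (real k * real n + (real n)\<^sup>2)"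
      by (simp add: algebra_simps)
    finally show ?thesis using A[of 0] by (intro mult_right_mono) auto
  qed
  also have "\<dots> = A 0 * (exp ((2 * \<rho> + ln K)\<^sup>2 / (4 * \<rho>)) * exp (- e * (real k * real n + (real n)\<^sup>2)))"
    by (simp only: exp_add mult_ac)
  finally show ?thesis by (simp only: n \<rho>_def mult.assoc)
qed

lemma hierarchical_step:
  assumes f: "fourier_series A f" "gaussian_ratio A c s" "\<And>x. 0 \<le> f x"
    and "0 < s" "0 \<le> c" "1 \<le> b" "0 < s'"
  shows "\<exists>A'. fourier_series A' (\<lambda>z. LINT \<zeta>|normal_law s'. f (z + \<zeta>) ^ b) \<and>
    gaussian_ratio A' (exp (- 2 * pi\<^sup>2 * s') * (real b * c)) s' \<and>
    (\<forall>z. normal_density 0 (sqrt s') 1 * A' 0 \<le> (LINT \<zeta>|normal_law s'. f (z + \<zeta>) ^ b))"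
proof -
  have "ratio_bounded A c"
    by (rule gaussian_ratio_imp_ratio_bounded[OF f(2) fourier_seriesD(1)[OF f(1)]]) fact+
  then obtain P where P: "fourier_series P (\<lambda>x. f x ^ b)" "ratio_bounded P (real b * c)"
    using fourier_series_power[OF f(1)] assms by blast
  let ?A = "\<lambda>q. exp (- 2 * pi\<^sup>2 * (of_int q)\<^sup>2 * s') * P q"
  have "fourier_series ?A (\<lambda>z. LINT \<zeta>|normal_law s'. f (z + \<zeta>) ^ b)"
    by (rule fourier_series_gaussian_average[OF P(1)]) fact
  moreover have "gaussian_ratio ?A (exp (- 2 * pi\<^sup>2 * s') * (real b * c)) s'"
    by (rule gaussian_ratio_gaussian_mult[OF P(2)])
  moreover have "normal_density 0 (sqrt s') 1 * ?A 0 \<le> (LINT \<zeta>|normal_law s'. f (z + \<zeta>) ^ b)" for z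
    using gaussian_average_lower_bound[OF P(1) _ \<open>0 < s'\<close>, of z] f(3) by simp
  ultimately show ?thesis by (intro exI[of _ ?A]) blast
qed

text \<open>
  The variable s plays the role of a variance, as in the later steps, so that the lower bound
  takes the same form: up to normalisation the kernel is the density of the normal law of
  variance s.
\<close>

lemma initial_step:
  assumes B: "assumption_B \<nu>" and s: "0 < s"
    and R: "\<And>q::nat. Re (fourier_coeff \<nu> (int q + 1)) \<le> R * Re (fourier_coeff \<nu> (int q))"
  shows "\<exists>A. fourier_series A (\<lambda>z. LINT \<zeta>|\<nu>. exp (- (1 / (2 * s)) * (z - \<zeta>)\<^sup>2)) \<and>
    gaussian_ratio A (exp (- 2 * pi\<^sup>2 * s) * R) s \<and>
    (\<forall>z. normal_density 0 (sqrt s) 1 * A 0 \<le> (LINT \<zeta>|\<nu>. exp (- (1 / (2 * s)) * (z - \<zeta>)\<^sup>2)))"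
proof -
  define P where "P q = sqrt (2 * pi * s) * Re (fourier_coeff \<nu> q)" for q
  let ?A = "\<lambda>q::int. exp (- 2 * pi\<^sup>2 * (of_int q)\<^sup>2 * s) * P q"
  have c: "0 < 1 / (2 * s)" using s by simp
  have "sqrt (pi / (1 / (2 * s))) * exp (- pi\<^sup>2 * (of_int q)\<^sup>2 / (1 / (2 * s))) * Re (fourier_coeff \<nu> q) = ?A q" for q
    using s by (simp add: P_def mult_ac)
  then have F: "fourier_series ?A (\<lambda>z. LINT \<zeta>|\<nu>. exp (- (1 / (2 * s)) * (z - \<zeta>)\<^sup>2))"
    using initial_fourier_series[OF B c] by simp
  have "ratio_bounded P R"
    unfolding ratio_bounded_def
  proof (intro allI impI)
    fix q :: int
    assume "0 \<le> q"
    then obtain n where "q = int n" using zero_le_imp_eq_int by blast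
    then have "Re (fourier_coeff \<nu> (q + 1)) \<le> R * Re (fourier_coeff \<nu> q)" using R[of n] by simp
    then have "sqrt (2 * pi * s) * Re (fourier_coeff \<nu> (q + 1)) \<le> sqrt (2 * pi * s) * (R * Re (fourier_coeff \<nu> q))"
      using s by (intro mult_left_mono) auto
    then show "P (q + 1) \<le> R * P q" by (simp add: P_def mult_ac)
  qed
  then have "gaussian_ratio ?A (exp (- 2 * pi\<^sup>2 * s) * R) s"
    by (rule gaussian_ratio_gaussian_mult)
  moreover have "normal_density 0 (sqrt s) 1 * ?A 0 \<le> (LINT \<zeta>|\<nu>. exp (- (1 / (2 * s)) * (z - \<zeta>)\<^sup>2))" for z
  proof -
    have "normal_density 0 (sqrt s) 1 * ?A 0 = exp (- (1 / (2 * s))) * Re (fourier_coeff \<nu> 0)"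
      using s by (simp add: normal_density_def P_def)
    then show ?thesis using initial_lower_bound[OF B c, of z] by simp
  qed
  ultimately show ?thesis using F by (intro exI[of _ ?A]) blast
qed

text \<open>
  Each step multiplies the constant by b e^{-2\<pi>^2 s_{k+1}/\<beta>}. The lower bound is part of
  the induction because the logarithm in the definition of v may only be undone once its
  argument is known to be positive.
\<close>

lemma v_fourier_series:
  assumes B: "assumption_B \<nu>" and b: "1 \<le> b" and \<beta>: "0 < \<beta>" and R0: "0 \<le> R"
    and R: "\<And>q::nat. Re (fourier_coeff \<nu> (int q + 1)) \<le> R * Re (fourier_coeff \<nu> (int q))"
    and s: "\<And>j. j \<le> k \<Longrightarrow> 0 < s j"
  shows "\<exists>A. fourier_series A (\<lambda>z. exp (- v b \<beta> \<nu> s k z)) \<and>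
    gaussian_ratio A (R * real b ^ k * exp (- (2 * pi\<^sup>2 / \<beta>) * (\<Sum>j\<le>k. s j))) (s k / \<beta>) \<and>
    (\<forall>z. normal_density 0 (sqrt (s k / \<beta>)) 1 * A 0 \<le> exp (- v b \<beta> \<nu> s k z))"
  using s
proof (induction k)
  case 0
  have s: "0 < s 0 / \<beta>" using 0 \<beta> by simp
  have e: "- (1 / (2 * (s 0 / \<beta>))) = - (1/2) * \<beta> * inverse (s 0)"
    using 0 \<beta> by (simp add: field_simps)
  obtain A where A: "fourier_series A (\<lambda>z. LINT \<zeta>|\<nu>. exp (- (1/2) * \<beta> * inverse (s 0) * (z - \<zeta>)\<^sup>2))"
    "gaussian_ratio A (exp (- 2 * pi\<^sup>2 * (s 0 / \<beta>)) * R) (s 0 / \<beta>)"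
    and low: "\<And>z. normal_density 0 (sqrt (s 0 / \<beta>)) 1 * A 0 \<le> (LINT \<zeta>|\<nu>. exp (- (1/2) * \<beta> * inverse (s 0) * (z - \<zeta>)\<^sup>2))"
    using initial_step[OF B s R] unfolding e by blast
  have "0 < normal_density 0 (sqrt (s 0 / \<beta>)) 1 * A 0"
    using s fourier_seriesD(1)[OF A(1)] by (intro mult_pos_pos normal_density_pos) auto
  then have "exp (- v b \<beta> \<nu> s 0 z) = (LINT \<zeta>|\<nu>. exp (- (1/2) * \<beta> * inverse (s 0) * (z - \<zeta>)\<^sup>2))" for z
    using less_le_trans[OF _ low[of z]] by simp
  moreover have "exp (- 2 * pi\<^sup>2 * (s 0 / \<beta>)) * R = R * real b ^ 0 * exp (- (2 * pi\<^sup>2 / \<beta>) * (\<Sum>j\<le>0. s j))"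
    by simp
  ultimately show ?case using A low by (intro exI[of _ A]) (simp only:, blast)
next
  case (Suc k)
  define c where "c = R * real b ^ k * exp (- (2 * pi\<^sup>2 / \<beta>) * (\<Sum>j\<le>k. s j))"
  obtain A where A: "fourier_series A (\<lambda>z. exp (- v b \<beta> \<nu> s k z))" "gaussian_ratio A c (s k / \<beta>)"
    using Suc.IH Suc.prems unfolding c_def by auto
  have s: "0 < s k / \<beta>" "0 < s (Suc k) / \<beta>" using Suc.prems \<beta> by auto
  have c: "0 \<le> c" using R0 by (simp add: c_def)
  let ?I = "\<lambda>z. LINT \<zeta>|normal_law (s (Suc k) / \<beta>). exp (- v b \<beta> \<nu> s k (z + \<zeta>)) ^ b"
  obtain A' where A': "fourier_series A' ?I"
    "gaussian_ratio A' (exp (- 2 * pi\<^sup>2 * (s (Suc k) / \<beta>)) * (real b * c)) (s (Suc k) / \<beta>)"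
    and low: "\<And>z. normal_density 0 (sqrt (s (Suc k) / \<beta>)) 1 * A' 0 \<le> ?I z"
    using hierarchical_step[OF A _ s(1) c b s(2)] by auto
  have "0 < normal_density 0 (sqrt (s (Suc k) / \<beta>)) 1 * A' 0"
    using s fourier_seriesD(1)[OF A'(1)] by (intro mult_pos_pos normal_density_pos) auto
  then have "0 < ?I z" for z using less_le_trans[OF _ low[of z]] by blast
  moreover have "exp (- real b * t) = exp (- t) ^ b" for t :: real
    by (simp flip: exp_of_nat_mult)
  ultimately have "exp (- v b \<beta> \<nu> s (Suc k) z) = ?I z" for z
    by simp
  moreover have "exp (- 2 * pi\<^sup>2 * (s (Suc k) / \<beta>)) * (real b * c)
      = R * real b ^ Suc k * exp (- (2 * pi\<^sup>2 / \<beta>) * (\<Sum>j\<le>Suc k. s j))"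
  proof -
    have "- (2 * pi\<^sup>2 / \<beta>) * (\<Sum>j\<le>Suc k. s j) = - 2 * pi\<^sup>2 * (s (Suc k) / \<beta>) + - (2 * pi\<^sup>2 / \<beta>) * (\<Sum>j\<le>k. s j)"
      by (simp add: algebra_simps add_divide_distrib)
    then show ?thesis by (simp only: c_def exp_add power_Suc mult_ac)
  qed
  ultimately show ?case using A' low by (intro exI[of _ A']) (simp only:, blast)
qed

lemma acoef_eq:
  assumes "fourier_series A (\<lambda>z. exp (- v b \<beta> \<nu> s k z))"
  shows "acoef b \<beta> \<nu> s k q = of_real (A q)"
proof -
  have "exp (- complex_of_real (v b \<beta> \<nu> s k z) - 2 * complex_of_real pi * \<i> * of_int q * complex_of_real z)
      = of_real (exp (- v b \<beta> \<nu> s k z)) * trig (- q) z" for z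
  proof -
    have "exp (- complex_of_real (v b \<beta> \<nu> s k z)) = of_real (exp (- v b \<beta> \<nu> s k z))"
      using exp_of_real[of "- v b \<beta> \<nu> s k z"] by simp
    moreover have "exp (- (2 * complex_of_real pi * \<i> * of_int q * complex_of_real z)) = trig (- q) z"
      by (simp add: trig_def cis_conv_exp mult_ac)
    ultimately show ?thesis by (simp only: diff_conv_add_uminus exp_add)
  qed
  then show ?thesis
    unfolding acoef_def by (simp only: fourier_series_coefficient[OF assms])
qed

text \<open>
  Move y by an integer to within distance 1 of x and use the mean value inequality.
\<close>

lemma periodic_oscillation_bound:
  fixes u :: "real \<Rightarrow> real"
  assumes diff: "\<And>x. u differentiable (at x)" and L: "\<And>x. \<bar>deriv u x\<bar> \<le> L"
    and per: "\<And>x m. u (x + of_int m) = u x"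
  shows "\<bar>u y - u x\<bar> \<le> L"
proof -
  define y' where "y' = y + of_int (- \<lfloor>y - x\<rfloor>)"
  have d: "(u has_real_derivative deriv u t) (at t)" for t
    using diff[of t] by (simp add: DERIV_deriv_iff_real_differentiable)
  have y': "u y' = u y" unfolding y'_def by (rule per)
  have "\<bar>y' - x\<bar> \<le> 1" unfolding y'_def by linarith
  have "norm (u y' - u x) \<le> L * norm (y' - x)"
    by (rule field_differentiable_bound[of UNIV u "deriv u"])
       (auto intro: has_field_derivative_at_within d L)
  also have "\<dots> \<le> L * 1"
    using \<open>\<bar>y' - x\<bar> \<le> 1\<close> L[of x] abs_ge_zero[of "deriv u x"] by (intro mult_left_mono) auto
  finally show ?thesis by (simp add: y')
qed

text \<open>
  The average of e^{-bu} lies between its extreme values, which differ from e^{-b u(z')} by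
  factors of at most e^{\<plusminus> bL}.
\<close>

lemma neg_ln_gaussian_average_bound:
  fixes u :: "real \<Rightarrow> real"
  assumes cont: "continuous_on UNIV u" and s: "0 < s" and osc: "\<And>x y. \<bar>u y - u x\<bar> \<le> L"
  shows "\<bar>- ln (LINT \<zeta>|normal_law s. exp (- real b * u (z + \<zeta>))) - real b * u z'\<bar> \<le> real b * L"
proof -
  interpret prob_space "normal_law s"
    unfolding normal_law_def using s by (intro prob_space_normal_density) simp
  let ?g = "\<lambda>\<zeta>. exp (- real b * u (z + \<zeta>))"
  have "continuous_on UNIV ?g"
    by (intro continuous_intros continuous_on_compose2[OF cont]) auto
  then have meas: "?g \<in> borel_measurable borel" by (rule borel_measurable_continuous_onI)
  have lo: "exp (- real b * u z' - real b * L) \<le> ?g \<zeta>" and hi: "?g \<zeta> \<le> exp (- real b * u z' + real b * L)" for \<zeta>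
  proof -
    have "real b * \<bar>u (z + \<zeta>) - u z'\<bar> \<le> real b * L" by (intro mult_left_mono osc) auto
    then have "\<bar>real b * u (z + \<zeta>) - real b * u z'\<bar> \<le> real b * L"
      by (simp add: abs_mult flip: right_diff_distrib)
    then show "exp (- real b * u z' - real b * L) \<le> ?g \<zeta>" "?g \<zeta> \<le> exp (- real b * u z' + real b * L)"
      by (auto simp: abs_le_iff)
  qed
  have int: "integrable (normal_law s) ?g"
  proof (rule integrable_const_bound)
    show "AE \<zeta> in normal_law s. norm (?g \<zeta>) \<le> exp (- real b * u z' + real b * L)"
      using hi by (intro AE_I2) (simp only: real_norm_def abs_exp_cancel)
    show "?g \<in> borel_measurable (normal_law s)"
      using meas by (simp add: normal_law_def)
  qed
  have 1: "exp (- real b * u z' - real b * L) \<le> expectation ?g"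
    using integral_mono[OF integrable_const int lo] by (simp add: prob_space)
  have 2: "expectation ?g \<le> exp (- real b * u z' + real b * L)"
    using integral_mono[OF int integrable_const hi] by (simp add: prob_space)
  have pos: "0 < expectation ?g" using less_le_trans[OF exp_gt_zero 1] .
  have "- real b * u z' - real b * L \<le> ln (expectation ?g)"
    using 1 pos by (simp only: ln_ge_iff)
  moreover have "ln (expectation ?g) \<le> - real b * u z' + real b * L"
    using ln_le_cancel_iff[OF pos exp_gt_zero] 2 by (simp only: ln_exp)
  ultimately show ?thesis by (simp only: abs_le_iff) linarith
qed

text \<open>
  The index min(j, n - j) is one of j and n - j, so the term is at most the sum of both.
\<close>

lemma sum_min_le_twice_suminf:
  fixes d :: "nat \<Rightarrow> real"
  assumes d: "\<And>j. 0 < d j" and s: "summable d" and k: "k \<le> n"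
  shows "(\<Sum>j\<le>k. d (min j (n - j))) \<le> 2 * suminf d"
proof -
  have "(\<Sum>j\<le>k. d (min j (n - j))) \<le> (\<Sum>j\<le>k. d j + d (n - j))"
    by (intro sum_mono) (auto simp: min_def less_imp_le d)
  also have "\<dots> = (\<Sum>j\<le>k. d j) + (\<Sum>j\<le>k. d (n - j))" by (rule sum.distrib)
  also have "(\<Sum>j\<le>k. d (n - j)) = sum d ((\<lambda>j. n - j) ` {..k})"
    by (subst sum.reindex) (use k in \<open>auto simp: inj_on_def\<close>)
  also have "(\<Sum>j\<le>k. d j) + \<dots> \<le> suminf d + suminf d"
    by (intro add_mono sum_le_suminf s) (auto simp: less_imp_le d)
  finally show ?thesis by simp
qed

section \<open>Decay of the Fourier coefficients and flattening of the potentials\<close>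

theorem theorem3p4:
  fixes b :: nat and \<beta> :: real
    and d :: "nat \<Rightarrow> real" and s2 :: "nat \<Rightarrow> nat \<Rightarrow> real" and \<nu> :: "real measure"
  assumes "assumption_A d s2" and "assumption_B \<nu>"
    and "b \<ge> 2" and "0 < \<beta>" and "\<beta> < 2 * pi\<^sup>2 / ln (real b)"
  shows "\<exists>\<eta>>0. \<exists>C>0.
    (\<forall>n\<ge>1. \<forall>k\<le>n. \<forall>q::int.
       acoef b \<beta> \<nu> (s2 n) k q / acoef b \<beta> \<nu> (s2 n) k 0 \<in> \<real> \<and>
       0 < Re (acoef b \<beta> \<nu> (s2 n) k q / acoef b \<beta> \<nu> (s2 n) k 0) \<and>
       Re (acoef b \<beta> \<nu> (s2 n) k q / acoef b \<beta> \<nu> (s2 n) k 0)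
         \<le> C * exp (- \<eta> * (real k * \<bar>real_of_int q\<bar> + (real_of_int q)\<^sup>2))) \<and>
    (\<forall>n\<ge>1. \<forall>k\<le>n. smooth_real (v b \<beta> \<nu> (s2 n) k)) \<and>
    (\<forall>n\<ge>1. \<forall>k<n. \<forall>z z'.
       \<bar>v b \<beta> \<nu> (s2 n) (Suc k) z - real b * v b \<beta> \<nu> (s2 n) k z'\<bar> \<le> C * exp (- \<eta> * real k)) \<and>
    (\<forall>n\<ge>1. \<forall>k\<le>n. \<forall>z.
       max \<bar>deriv (v b \<beta> \<nu> (s2 n) k) z\<bar> \<bar>deriv (deriv (v b \<beta> \<nu> (s2 n) k)) z\<bar>
         \<le> C * exp (- \<eta> * real k))"
proof -
  have d: "\<And>j. 0 < d j" "summable d"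
    and s2: "\<And>n k. 1 \<le> n \<Longrightarrow> k \<le> n \<Longrightarrow> 0 < s2 n k \<and> \<bar>s2 n k - 1\<bar> \<le> d (min k (n - k))"
    using assms(1) by (auto simp: assumption_A_def)
  define \<delta> where "\<delta> = (INF (n, k) \<in> {(n, k). 1 \<le> n \<and> k \<le> n}. s2 n k)"
  have \<delta>: "0 < \<delta>" using assms(1) by (simp add: assumption_A_def \<delta>_def)
  have lower: "\<delta> \<le> s2 n k" if "1 \<le> n" "k \<le> n" for n k
  proof -
    have "bdd_below ((\<lambda>(n, k). s2 n k) ` {(n, k). 1 \<le> n \<and> k \<le> n})"
      using s2 by (intro bdd_belowI[of _ 0]) (auto intro: less_imp_le)
    from cINF_lower[OF this, of "(n, k)"] show ?thesis using that by (simp add: \<delta>_def)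
  qed
  define D where "D = suminf d"
  have dD: "d j \<le> D" for j
    unfolding D_def using sum_le_suminf[OF d(2), of "{j}"] by (simp add: d less_imp_le)
  define S where "S = 1 + D"
  have upper: "s2 n k \<le> S" if "1 \<le> n" "k \<le> n" for n k
    using conjunct2[OF s2[OF that]] dD[of "min k (n - k)"] unfolding S_def by linarith
  have S: "0 < S" using \<delta> lower[of 1 0] upper[of 1 0] by linarith
  obtain R0 where R0: "\<And>q::nat. Re (fourier_coeff \<nu> (int q + 1)) / Re (fourier_coeff \<nu> (int q)) \<le> R0"
    using assms(2) unfolding assumption_B_def bdd_above_def by auto
  define R where "R = max 1 R0"
  have R: "Re (fourier_coeff \<nu> (int q + 1)) \<le> R * Re (fourier_coeff \<nu> (int q))" for q :: nat
  proof -
    have p: "0 < Re (fourier_coeff \<nu> (int q))" using assms(2) by (simp add: assumption_B_def)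
    then have "Re (fourier_coeff \<nu> (int q + 1)) \<le> R0 * Re (fourier_coeff \<nu> (int q))"
      using R0[of q] by (simp add: pos_divide_le_eq)
    also have "\<dots> \<le> R * Re (fourier_coeff \<nu> (int q))"
      using p by (intro mult_right_mono) (auto simp: R_def)
    finally show ?thesis .
  qed
  have Rpos: "0 < R" by (simp add: R_def)
  have b1: "1 \<le> b" "0 < ln (real b)" using assms(3) by auto
  define \<kappa> where "\<kappa> = 2 * pi\<^sup>2 / \<beta> - ln (real b)"
  have \<kappa>: "0 < \<kappa>" using assms(4,5) b1 by (simp add: \<kappa>_def field_simps)
  define K where "K = R * exp (4 * pi\<^sup>2 * D / \<beta>)"
  have K: "0 < K" using Rpos by (simp add: K_def)
  \<comment> \<open>Subcriticality enters here: the exponential rate is positive because beta is below the critical value, and the deviations of the variances from 1 cost only the constant factor in K.\<close>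
  have coupling: "R * real b ^ k * exp (- (2 * pi\<^sup>2 / \<beta>) * (\<Sum>j\<le>k. s2 n j)) \<le> K * exp (- \<kappa> * real k)"
    if "1 \<le> n" "k \<le> n" for n k
  proof -
    have "real k - 2 * D \<le> (\<Sum>j\<le>k. 1 - d (min j (n - j)))"
      using sum_min_le_twice_suminf[OF d that(2)] by (simp add: sum_subtractf D_def)
    also have "\<dots> \<le> (\<Sum>j\<le>k. s2 n j)"
    proof (rule sum_mono)
      fix j assume "j \<in> {..k}"
      then show "1 - d (min j (n - j)) \<le> s2 n j" using s2[OF that(1), of j] that(2) by auto
    qed
    finally have "(2 * pi\<^sup>2 / \<beta>) * (real k - 2 * D) \<le> (2 * pi\<^sup>2 / \<beta>) * (\<Sum>j\<le>k. s2 n j)"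
      using assms(4) by (intro mult_left_mono) auto
    moreover have "(2 * pi\<^sup>2 / \<beta>) * (real k - 2 * D) = \<kappa> * real k + real k * ln (real b) - 4 * pi\<^sup>2 * D / \<beta>"
      using assms(4) by (simp add: \<kappa>_def field_simps)
    ultimately have le: "real k * ln (real b) + - (2 * pi\<^sup>2 / \<beta>) * (\<Sum>j\<le>k. s2 n j) \<le> 4 * pi\<^sup>2 * D / \<beta> + - \<kappa> * real k"
      by linarith
    have "real b ^ k = exp (real k * ln (real b))"
      using b1 by (simp add: exp_of_nat_mult)
    then have "R * real b ^ k * exp (- (2 * pi\<^sup>2 / \<beta>) * (\<Sum>j\<le>k. s2 n j))
        = R * exp (real k * ln (real b) + - (2 * pi\<^sup>2 / \<beta>) * (\<Sum>j\<le>k. s2 n j))"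
      by (simp only: exp_add mult.assoc)
    also have "\<dots> \<le> R * exp (4 * pi\<^sup>2 * D / \<beta> + - \<kappa> * real k)"
      using le Rpos by (intro mult_left_mono) auto
    also have "\<dots> = K * exp (- \<kappa> * real k)" by (simp only: K_def exp_add mult.assoc)
    finally show ?thesis .
  qed
  define \<sigma> where "\<sigma> = \<delta> / \<beta>"
  have \<sigma>: "0 < \<sigma>" using \<delta> assms(4) by (simp add: \<sigma>_def)
  define \<eta> where "\<eta> = min (pi\<^sup>2 * \<sigma>) \<kappa>"
  have \<eta>: "0 < \<eta>" "\<eta> \<le> pi\<^sup>2 * \<sigma>" "\<eta> \<le> \<kappa>" using \<sigma> \<kappa> by (auto simp: \<eta>_def)
  define C0 where "C0 = exp ((2 * pi\<^sup>2 * \<sigma> + ln K)\<^sup>2 / (4 * (pi\<^sup>2 * \<sigma>)))"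
  have C0: "0 < C0" by (simp add: C0_def)
  \<comment> \<open>A lower bound for the value at 1 of every centred normal density with variance between \<delta>/\<beta> and S/\<beta>: the larger variance is taken in the prefactor and the smaller one in the exponent.\<close>
  define m where "m = 1 / sqrt (2 * pi * (S / \<beta>)) * exp (- (\<beta> / (2 * \<delta>)))"
  have m: "0 < m" using S assms(4) by (simp add: m_def)
  define E where "E = C0 * (\<Sum>\<^sub>\<infinity>q::int. exp (- \<eta> * (of_int q)\<^sup>2 + 2 * pi * \<bar>of_int q\<bar>))"
  have E: "0 \<le> E" using C0 by (auto simp: E_def intro!: mult_nonneg_nonneg infsum_nonneg)
  define C where "C = C0 + real b * (E / m) + (2 * E / m + (E / m)\<^sup>2)"
  have Em: "0 \<le> E / m" using E m by simp
  then have bEm: "0 \<le> real b * (E / m)" by (intro mult_nonneg_nonneg) simp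
  have C: "0 < C" "C0 \<le> C" "real b * (E / m) \<le> C" "E / m \<le> C" "2 * E / m + (E / m)\<^sup>2 \<le> C"
    using C0 Em bEm zero_le_power2[of "E / m"] unfolding C_def times_divide_eq_right [symmetric] by linarith+
  have main: "\<exists>A. fourier_series A (\<lambda>z. exp (- v b \<beta> \<nu> (s2 n) k z)) \<and>
      (\<forall>q. A q \<le> A 0 * (C0 * exp (- \<eta> * (real k * \<bar>of_int q\<bar> + (of_int q)\<^sup>2)))) \<and>
      (\<forall>z. m * A 0 \<le> exp (- v b \<beta> \<nu> (s2 n) k z))" if n: "1 \<le> n" "k \<le> n" for n k
  proof -
    have pos: "0 < s2 n j" if "j \<le> k" for j using s2[OF n(1), of j] that n(2) by simp
    obtain A where A: "fourier_series A (\<lambda>z. exp (- v b \<beta> \<nu> (s2 n) k z))"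
      and ratio: "gaussian_ratio A (R * real b ^ k * exp (- (2 * pi\<^sup>2 / \<beta>) * (\<Sum>j\<le>k. s2 n j))) (s2 n k / \<beta>)"
      and low: "\<And>z. normal_density 0 (sqrt (s2 n k / \<beta>)) 1 * A 0 \<le> exp (- v b \<beta> \<nu> (s2 n) k z)"
      using v_fourier_series[of \<nu> b \<beta> R k "s2 n", OF assms(2) b1(1) assms(4) less_imp_le[OF Rpos] R pos] by blast
    have "A q \<le> A 0 * (C0 * exp (- \<eta> * (real k * \<bar>of_int q\<bar> + (of_int q)\<^sup>2)))" for q
      unfolding C0_def
    proof (rule gaussian_ratio_decay[OF ratio fourier_seriesD(1,2)[OF A] _ coupling[OF n] K _ \<sigma> \<eta>(2,3)])
      show "\<sigma> \<le> s2 n k / \<beta>" unfolding \<sigma>_def using lower[OF n] assms(4) by (simp add: divide_right_mono)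
    qed (use Rpos in simp)
    moreover have "m * A 0 \<le> exp (- v b \<beta> \<nu> (s2 n) k z)" for z
    proof -
      have p: "0 < s2 n k" using pos by simp
      have nd: "normal_density 0 (sqrt (s2 n k / \<beta>)) 1
          = 1 / sqrt (2 * pi * (s2 n k / \<beta>)) * exp (- (\<beta> / (2 * s2 n k)))"
        using p assms(4) by (simp add: normal_density_def)
      have "m \<le> normal_density 0 (sqrt (s2 n k / \<beta>)) 1"
        unfolding nd m_def
      proof (rule mult_mono)
        show "1 / sqrt (2 * pi * (S / \<beta>)) \<le> 1 / sqrt (2 * pi * (s2 n k / \<beta>))"
          using p assms(4) upper[OF n] by (intro divide_left_mono real_sqrt_le_mono mult_left_mono divide_right_mono) (auto intro!: mult_pos_pos divide_pos_pos S)
        have "\<beta> / (2 * s2 n k) \<le> \<beta> / (2 * \<delta>)"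
          using p \<delta> assms(4) lower[OF n] by (intro divide_left_mono) auto
        then show "exp (- (\<beta> / (2 * \<delta>))) \<le> exp (- (\<beta> / (2 * s2 n k)))" by simp
      qed (use p assms(4) in auto)
      then show ?thesis
        using mult_right_mono[of m _ "A 0"] fourier_seriesD(1)[OF A, of 0] low[of z]
        by (meson less_imp_le order_trans)
    qed
    ultimately show ?thesis using A by blast
  qed
  have vln: "v b \<beta> \<nu> s k = (\<lambda>z. - ln (exp (- v b \<beta> \<nu> s k z)))" for s k by simp
  have regular: "smooth_real (v b \<beta> \<nu> (s2 n) k)" "v b \<beta> \<nu> (s2 n) k differentiable (at z)"
      "\<bar>deriv (v b \<beta> \<nu> (s2 n) k) z\<bar> \<le> E / m * exp (- \<eta> * real k)"
      "\<bar>deriv (deriv (v b \<beta> \<nu> (s2 n) k)) z\<bar> \<le> (2 * E / m + (E / m)\<^sup>2) * exp (- \<eta> * real k)"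
      "v b \<beta> \<nu> (s2 n) k (z + of_int i) = v b \<beta> \<nu> (s2 n) k z"
    if n: "1 \<le> n" "k \<le> n" for n k z i
  proof -
    obtain A where A: "fourier_series A (\<lambda>z. exp (- v b \<beta> \<nu> (s2 n) k z))"
      and decay: "\<And>q. A q \<le> A 0 * (C0 * exp (- \<eta> * (real k * \<bar>of_int q\<bar> + (of_int q)\<^sup>2)))"
      and low: "\<And>z. m * A 0 \<le> exp (- v b \<beta> \<nu> (s2 n) k z)"
      using main[OF n] by blast
    note reg = log_fourier_series_smooth_and_flat[OF A \<eta>(1) less_imp_le[OF C0] m decay low, folded E_def vln]
    show "smooth_real (v b \<beta> \<nu> (s2 n) k)" "v b \<beta> \<nu> (s2 n) k differentiable (at z)"
      "\<bar>deriv (v b \<beta> \<nu> (s2 n) k) z\<bar> \<le> E / m * exp (- \<eta> * real k)"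
      "\<bar>deriv (deriv (v b \<beta> \<nu> (s2 n) k)) z\<bar> \<le> (2 * E / m + (E / m)\<^sup>2) * exp (- \<eta> * real k)"
      by (fact reg)+
    show "v b \<beta> \<nu> (s2 n) k (z + of_int i) = v b \<beta> \<nu> (s2 n) k z"
      using fourier_series_periodic[OF A, of z i] by simp
  qed
  have c1: "acoef b \<beta> \<nu> (s2 n) k q / acoef b \<beta> \<nu> (s2 n) k 0 \<in> \<real> \<and>
       0 < Re (acoef b \<beta> \<nu> (s2 n) k q / acoef b \<beta> \<nu> (s2 n) k 0) \<and>
       Re (acoef b \<beta> \<nu> (s2 n) k q / acoef b \<beta> \<nu> (s2 n) k 0)
         \<le> C * exp (- \<eta> * (real k * \<bar>real_of_int q\<bar> + (real_of_int q)\<^sup>2))"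
    if n: "1 \<le> n" "k \<le> n" for n k q
  proof -
    obtain A where A: "fourier_series A (\<lambda>z. exp (- v b \<beta> \<nu> (s2 n) k z))"
      and decay: "\<And>q. A q \<le> A 0 * (C0 * exp (- \<eta> * (real k * \<bar>of_int q\<bar> + (of_int q)\<^sup>2)))"
      using main[OF n] by blast
    have pos: "0 < A q" "0 < A 0" using fourier_seriesD(1)[OF A] by auto
    have eq: "acoef b \<beta> \<nu> (s2 n) k q / acoef b \<beta> \<nu> (s2 n) k 0 = of_real (A q / A 0)"
      by (simp add: acoef_eq[OF A])
    have "A q / A 0 \<le> C0 * exp (- \<eta> * (real k * \<bar>of_int q\<bar> + (of_int q)\<^sup>2))"
      using decay[of q] pos by (simp add: pos_divide_le_eq mult.commute)
    also have "\<dots> \<le> C * exp (- \<eta> * (real k * \<bar>of_int q\<bar> + (of_int q)\<^sup>2))"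
      using C(2) by (intro mult_right_mono) auto
    finally show ?thesis unfolding eq using pos by simp
  qed
  have c3: "\<bar>v b \<beta> \<nu> (s2 n) (Suc k) z - real b * v b \<beta> \<nu> (s2 n) k z'\<bar> \<le> C * exp (- \<eta> * real k)"
    if n: "1 \<le> n" "k < n" for n k z z'
  proof -
    have n': "k \<le> n" "Suc k \<le> n" using n by auto
    note reg = regular[OF n(1) n'(1)]
    have cont: "continuous_on UNIV (v b \<beta> \<nu> (s2 n) k)"
      using reg(2) by (auto intro!: continuous_at_imp_continuous_on differentiable_imp_continuous_within)
    have "0 < s2 n (Suc k) / \<beta>" using s2[OF n(1) n'(2)] assms(4) by simp
    from neg_ln_gaussian_average_bound[OF cont this periodic_oscillation_bound[OF reg(2,3,5)], of b z z']
    have "\<bar>v b \<beta> \<nu> (s2 n) (Suc k) z - real b * v b \<beta> \<nu> (s2 n) k z'\<bar> \<le> real b * (E / m) * exp (- \<eta> * real k)"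
      by (simp add: mult.assoc)
    also have "\<dots> \<le> C * exp (- \<eta> * real k)" using C(3) by (intro mult_right_mono) auto
    finally show ?thesis .
  qed
  have c4: "max \<bar>deriv (v b \<beta> \<nu> (s2 n) k) z\<bar> \<bar>deriv (deriv (v b \<beta> \<nu> (s2 n) k)) z\<bar> \<le> C * exp (- \<eta> * real k)"
    if n: "1 \<le> n" "k \<le> n" for n k z
  proof -
    have "E / m * exp (- \<eta> * real k) \<le> C * exp (- \<eta> * real k)"
      "(2 * E / m + (E / m)\<^sup>2) * exp (- \<eta> * real k) \<le> C * exp (- \<eta> * real k)"
      by (rule mult_right_mono[OF C(4) exp_ge_zero] mult_right_mono[OF C(5) exp_ge_zero])+
    then show ?thesis using regular(3,4)[OF n, of z] by (intro max.boundedI) linarith+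
  qed
  show ?thesis
    by (rule exI[of _ \<eta>], rule conjI[OF \<eta>(1)], rule exI[of _ C], rule conjI[OF C(1)])
       (intro conjI; intro allI impI; (rule c1 | rule regular(1) | rule c3 | rule c4); assumption)
qed

end
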